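(* Let $n \in \mathbb{N}$ be odd and let $\mathbf{u} = (u_1,u_2,u_3) \in \mathbb{N}^3$ be a solution to $$\frac{4}{n} = \frac{1}{u_1} + \frac{1}{u_2} + \frac{1}{u_3}.$$ Then $$\prod_{p \mid n} (-u_1/u_3, -u_2/u_3)_p = -1,$$ where the product is over the primes $p$ dividing $n$.
   Context: $\mathbb{N}$ denotes the positive integers. For a prime $p$ and $a,b \in \mathbb{Q}_p^*$, $(a,b)_p \in \{\pm 1\}$ denotes the Hilbert symbol: it is $1$ if $z^2 = ax^2+by^2$ has a non-trivial solution in $\mathbb{Q}_p$, and $-1$ otherwise. An empty product equals $1$. *)

theory Defs
  imports Complex_Main "HOL-Algebra.QuotRing" "HOL-Computational_Algebra.Primes"
begin

section \<open>The field of p-adic numbers\<close>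

text \<open>
  The field of \<open>p\<close>-adic numbers is the completion of the rationals for the \<open>p\<close>-adic absolute
  value: the ring of \<open>p\<close>-adic Cauchy sequences of rationals modulo the ideal of null sequences.
  The prime \<open>p\<close> is an ordinary argument, so the field is an algebraic structure with an explicit
  carrier and not a type.
\<close>

definition padic_val :: "nat \<Rightarrow> rat \<Rightarrow> int" where
  "padic_val p x = int (multiplicity (int p) (fst (quotient_of x)))
                 - int (multiplicity (int p) (snd (quotient_of x)))"

definition padic_abs :: "nat \<Rightarrow> rat \<Rightarrow> real" where
  "padic_abs p x = (if x = 0 then 0 else real p powi (- padic_val p x))"

definition padic_Cauchy :: "nat \<Rightarrow> (nat \<Rightarrow> rat) \<Rightarrow> bool" where
  "padic_Cauchy p s \<longleftrightarrow> (\<forall>e>0. \<exists>N. \<forall>m\<ge>N. \<forall>n\<ge>N. padic_abs p (s m - s n) < e)"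

definition padic_null :: "nat \<Rightarrow> (nat \<Rightarrow> rat) \<Rightarrow> bool" where
  "padic_null p s \<longleftrightarrow> (\<lambda>n. padic_abs p (s n)) \<longlonglongrightarrow> 0"

definition padic_Cauchy_ring :: "nat \<Rightarrow> (nat \<Rightarrow> rat) ring" where
  "padic_Cauchy_ring p =
    \<lparr>carrier = {s. padic_Cauchy p s},
     monoid.mult = (\<lambda>s t n. s n * t n), one = (\<lambda>_. 1),
     zero = (\<lambda>_. 0), add = (\<lambda>s t n. s n + t n)\<rparr>"

definition padic_field :: "nat \<Rightarrow> (nat \<Rightarrow> rat) set ring" where
  "padic_field p = padic_Cauchy_ring p Quot {s. padic_null p s}"

text \<open>The canonical embedding of the rationals: the class of the constant sequence.\<close>

definition padic_of_rat :: "nat \<Rightarrow> rat \<Rightarrow> (nat \<Rightarrow> rat) set" where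
  "padic_of_rat p x = {s. padic_null p s} +>\<^bsub>padic_Cauchy_ring p\<^esub> (\<lambda>_. x)"


section \<open>The Hilbert symbol\<close>

text \<open>Only meaningful for \<open>p\<close> prime and \<open>a\<close>, \<open>b\<close> nonzero elements of \<^term>\<open>padic_field p\<close>.\<close>

definition hilbert_symbol :: "nat \<Rightarrow> (nat \<Rightarrow> rat) set \<Rightarrow> (nat \<Rightarrow> rat) set \<Rightarrow> int" where
  "hilbert_symbol p a b =
    (let K = padic_field p in
     if \<exists>x\<in>carrier K. \<exists>y\<in>carrier K. \<exists>z\<in>carrier K.
          (x, y, z) \<noteq> (\<zero>\<^bsub>K\<^esub>, \<zero>\<^bsub>K\<^esub>, \<zero>\<^bsub>K\<^esub>) \<and>
          z [^]\<^bsub>K\<^esub> (2::nat) =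
            a \<otimes>\<^bsub>K\<^esub> x [^]\<^bsub>K\<^esub> (2::nat) \<oplus>\<^bsub>K\<^esub> b \<otimes>\<^bsub>K\<^esub> y [^]\<^bsub>K\<^esub> (2::nat)
     then 1 else - 1)"


section \<open>Basic facts\<close>

lemma padic_val_of_int_div:
  assumes "prime p" "a \<noteq> 0" "b \<noteq> 0"
  shows "padic_val p (of_int a / of_int b) =
           int (multiplicity (int p) a) - int (multiplicity (int p) b)"
proof -
  obtain c d where cd: "quotient_of (of_int a / of_int b) = (c, d)"
    by fastforce
  have d: "d > 0" using cd by (rule quotient_of_denom_pos)
  have eq: "of_int a / of_int b = (of_int c / of_int d :: rat)"
    using cd by (rule quotient_of_div)
  with d assms have c: "c \<noteq> 0" by auto
  have "(of_int (a * d) :: rat) = of_int (c * b)"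
    using eq d assms by (simp add: field_simps)
  then have "a * d = c * b" by (simp only: of_int_eq_iff)
  moreover have pe: "prime_elem (int p)" using assms by (simp add: prime_imp_prime_elem)
  ultimately have "multiplicity (int p) a + multiplicity (int p) d =
      multiplicity (int p) c + multiplicity (int p) b"
    using prime_elem_multiplicity_mult_distrib[OF pe, of a d]
      prime_elem_multiplicity_mult_distrib[OF pe, of c b] assms c d by simp
  then show ?thesis by (simp add: padic_val_def cd)
qed

lemma padic_abs_0 [simp]: "padic_abs p 0 = 0"
  by (simp add: padic_abs_def)

lemma padic_abs_1 [simp]: "padic_abs p 1 = 1"
  by (simp add: padic_abs_def padic_val_def)

lemma padic_abs_nonneg [simp]: "padic_abs p x \<ge> 0"
  by (simp add: padic_abs_def)

lemma padic_abs_eq_0_iff: "prime p \<Longrightarrow> padic_abs p x = 0 \<longleftrightarrow> x = 0"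
  by (auto simp: padic_abs_def prime_gt_0_nat)

lemma padic_abs_mult:
  assumes "prime p"
  shows "padic_abs p (x * y) = padic_abs p x * padic_abs p y"
proof (cases "x = 0 \<or> y = 0")
  case False
  obtain a b where x: "x = of_int a / of_int b" and b: "b > 0"
    by (metis quotient_of_denom_pos quotient_of_div surj_pair)
  obtain c d where y: "y = of_int c / of_int d" and d: "d > 0"
    by (metis quotient_of_denom_pos quotient_of_div surj_pair)
  have nz: "a \<noteq> 0" "c \<noteq> 0" using False x y by auto
  have pe: "prime_elem (int p)" using assms by (simp add: prime_imp_prime_elem)
  have xy: "x * y = of_int (a * c) / of_int (b * d)" by (simp add: x y)
  have "padic_val p (x * y) = padic_val p x + padic_val p y"
    using padic_val_of_int_div[OF assms, of "a * c" "b * d"]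
      padic_val_of_int_div[OF assms, of a b] padic_val_of_int_div[OF assms, of c d]
      nz b d prime_elem_multiplicity_mult_distrib[OF pe, of a c]
      prime_elem_multiplicity_mult_distrib[OF pe, of b d]
    by (simp add: xy) (simp add: x y)
  moreover have "real p \<noteq> 0" using assms prime_gt_0_nat by auto
  ultimately show ?thesis
    using False by (simp add: padic_abs_def power_int_add[symmetric])
qed (auto simp: padic_abs_def)

lemma padic_abs_minus [simp]:
  assumes "prime p"
  shows "padic_abs p (- x) = padic_abs p x"
proof -
  have "padic_abs p (- 1) = 1" by (simp add: padic_abs_def padic_val_def multiplicity_unit_right)
  then show ?thesis using padic_abs_mult[OF assms, of "- 1" x] by simp
qed

lemma padic_abs_minus_commute: "prime p \<Longrightarrow> padic_abs p (x - y) = padic_abs p (y - x)"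
  using padic_abs_minus[of p "x - y"] by simp

lemma padic_abs_inverse:
  assumes "prime p"
  shows "padic_abs p (inverse x) = inverse (padic_abs p x)"
proof (cases "x = 0")
  case False
  then have "padic_abs p x * padic_abs p (inverse x) = 1"
    using padic_abs_mult[OF assms, of x "inverse x"] by simp
  then show ?thesis by (metis inverse_unique)
qed simp

lemma padic_abs_add:
  assumes "prime p"
  shows "padic_abs p (x + y) \<le> max (padic_abs p x) (padic_abs p y)"
proof (cases "x = 0 \<or> y = 0 \<or> x + y = 0")
  case False
  obtain a b where x: "x = of_int a / of_int b" and b: "b > 0"
    by (metis quotient_of_denom_pos quotient_of_div surj_pair)
  obtain c d where y: "y = of_int c / of_int d" and d: "d > 0"
    by (metis quotient_of_denom_pos quotient_of_div surj_pair)
  define A where "A = a * d"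
  define C where "C = c * b"
  define D where "D = b * d"
  have D: "D \<noteq> 0" using b d by (simp add: D_def)
  have xA: "x = of_int A / of_int D" and yC: "y = of_int C / of_int D"
    using b d by (simp_all add: x y A_def C_def D_def)
  then have xy: "x + y = of_int (A + C) / of_int D" by (simp add: add_divide_distrib)
  have nz: "A \<noteq> 0" "C \<noteq> 0" "A + C \<noteq> 0" using False xA yC xy by auto
  let ?k = "min (multiplicity (int p) A) (multiplicity (int p) C)"
  have "int p ^ ?k dvd A + C"
    by (intro dvd_add multiplicity_dvd') simp_all
  then have "?k \<le> multiplicity (int p) (A + C)"
    using nz assms by (intro multiplicity_geI) (auto simp: not_prime_1)
  then have "min (padic_val p x) (padic_val p y) \<le> padic_val p (x + y)"
    using padic_val_of_int_div[OF assms nz(1) D] padic_val_of_int_div[OF assms nz(2) D]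
      padic_val_of_int_div[OF assms nz(3) D]
    unfolding xy xA[symmetric] yC[symmetric] by (simp add: min_def split: if_splits)
  then have "padic_val p x \<le> padic_val p (x + y) \<or> padic_val p y \<le> padic_val p (x + y)"
    by linarith
  moreover have "real p \<ge> 1" using assms prime_ge_1_nat by force
  ultimately have "padic_abs p (x + y) \<le> padic_abs p x \<or> padic_abs p (x + y) \<le> padic_abs p y"
    using False by (auto simp: padic_abs_def intro!: power_int_increasing)
  then show ?thesis by linarith
qed (auto simp: max_def)

lemma padic_abs_triangle:
  "prime p \<Longrightarrow> padic_abs p (x + y) \<le> padic_abs p x + padic_abs p y"
  using padic_abs_add[of p x y] padic_abs_nonneg[of p x] padic_abs_nonneg[of p y] by linarith

lemma padic_CauchyD:
  "padic_Cauchy p s \<Longrightarrow> e > 0 \<Longrightarrow> \<exists>N. \<forall>m\<ge>N. \<forall>n\<ge>N. padic_abs p (s m - s n) < e"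
  by (simp add: padic_Cauchy_def)

lemma padic_Cauchy_const: "padic_Cauchy p (\<lambda>_. x)"
  by (simp add: padic_Cauchy_def)

lemma padic_Cauchy_add:
  assumes "prime p" "padic_Cauchy p s" "padic_Cauchy p t"
  shows "padic_Cauchy p (\<lambda>n. s n + t n)"
  unfolding padic_Cauchy_def
proof (intro allI impI)
  fix e :: real assume "e > 0"
  then obtain M N where
    M: "\<forall>m\<ge>M. \<forall>n\<ge>M. padic_abs p (s m - s n) < e" and
    N: "\<forall>m\<ge>N. \<forall>n\<ge>N. padic_abs p (t m - t n) < e"
    using assms padic_CauchyD by meson
  have "padic_abs p (s m + t m - (s n + t n)) < e" if "m \<ge> max M N" "n \<ge> max M N" for m n
  proof -
    have "s m + t m - (s n + t n) = (s m - s n) + (t m - t n)" by simp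
    with padic_abs_add[OF assms(1), of "s m - s n" "t m - t n"] M N that show ?thesis
      by (metis max.bounded_iff max_less_iff_conj order.strict_trans1)
  qed
  then show "\<exists>N. \<forall>m\<ge>N. \<forall>n\<ge>N. padic_abs p (s m + t m - (s n + t n)) < e" by blast
qed

lemma padic_Cauchy_bounded:
  assumes "prime p" "padic_Cauchy p s"
  obtains B where "B > 0" "\<And>n. padic_abs p (s n) \<le> B"
proof -
  obtain N where N: "\<forall>m\<ge>N. \<forall>n\<ge>N. padic_abs p (s m - s n) < 1"
    using padic_CauchyD[OF assms(2)] by (meson zero_less_one)
  define B where "B = 1 + (\<Sum>i\<le>N. padic_abs p (s i))"
  have le: "padic_abs p (s i) \<le> B - 1" if "i \<le> N" for i
    using that by (auto simp: B_def intro!: member_le_sum)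
  have "padic_abs p (s n) \<le> B" for n
  proof (cases "n \<le> N")
    case False
    then have "padic_abs p (s n - s N) < 1" using N by simp
    then show ?thesis
      using padic_abs_triangle[OF assms(1), of "s n - s N" "s N"] le[of N] by simp
  qed (use le in force)
  moreover have "B > 0" using le[of N] padic_abs_nonneg[of p "s N"] by linarith
  ultimately show ?thesis by (rule that[rotated])
qed

lemma padic_Cauchy_mult:
  assumes "prime p" "padic_Cauchy p s" "padic_Cauchy p t"
  shows "padic_Cauchy p (\<lambda>n. s n * t n)"
  unfolding padic_Cauchy_def
proof (intro allI impI)
  fix e :: real assume e: "e > 0"
  obtain B where B: "B > 0" "\<And>n. padic_abs p (s n) \<le> B"
    using padic_Cauchy_bounded assms by blast
  obtain C where C: "C > 0" "\<And>n. padic_abs p (t n) \<le> C"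
    using padic_Cauchy_bounded assms by blast
  obtain M N where
    M: "\<forall>m\<ge>M. \<forall>n\<ge>M. padic_abs p (s m - s n) < e / (2 * C)" and
    N: "\<forall>m\<ge>N. \<forall>n\<ge>N. padic_abs p (t m - t n) < e / (2 * B)"
    using assms(2,3)[THEN padic_CauchyD] e B C
    by (metis divide_pos_pos mult_pos_pos zero_less_numeral)
  have "padic_abs p (s m * t m - s n * t n) < e" if "m \<ge> max M N" "n \<ge> max M N" for m n
  proof -
    have "s m * t m - s n * t n = s m * (t m - t n) + (s m - s n) * t n"
      by (simp add: algebra_simps)
    then have "padic_abs p (s m * t m - s n * t n) \<le>
        padic_abs p (s m) * padic_abs p (t m - t n) + padic_abs p (s m - s n) * padic_abs p (t n)"
      using padic_abs_triangle[OF assms(1)] by (simp flip: padic_abs_mult[OF assms(1)])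
    also have "\<dots> \<le> B * padic_abs p (t m - t n) + padic_abs p (s m - s n) * C"
      using B C by (intro add_mono mult_mono) auto
    also have "\<dots> < B * (e / (2 * B)) + e / (2 * C) * C"
      using M N that B C by (intro add_strict_mono mult_strict_left_mono mult_strict_right_mono) auto
    also have "\<dots> = e" using B C by simp
    finally show ?thesis .
  qed
  then show "\<exists>N. \<forall>m\<ge>N. \<forall>n\<ge>N. padic_abs p (s m * t m - s n * t n) < e" by blast
qed

lemma padic_null_imp_Cauchy:
  assumes "prime p" "padic_null p s"
  shows "padic_Cauchy p s"
  unfolding padic_Cauchy_def
proof (intro allI impI)
  fix e :: real assume "e > 0"
  then obtain N where N: "\<forall>n\<ge>N. padic_abs p (s n) < e"
    using assms(2) unfolding padic_null_def LIMSEQ_iff by auto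
  have "padic_abs p (s m - s n) < e" if "m \<ge> N" "n \<ge> N" for m n
    using padic_abs_add[OF assms(1), of "s m" "- s n"] N that assms(1)
    by (metis max_less_iff_conj order.strict_trans1 padic_abs_minus uminus_add_conv_diff
        add.commute)
  then show "\<exists>N. \<forall>m\<ge>N. \<forall>n\<ge>N. padic_abs p (s m - s n) < e" by blast
qed

lemma padic_null_add:
  assumes "prime p" "padic_null p s" "padic_null p t"
  shows "padic_null p (\<lambda>n. s n + t n)"
proof -
  have "(\<lambda>n. padic_abs p (s n) + padic_abs p (t n)) \<longlonglongrightarrow> 0"
    using tendsto_add[OF assms(2,3)[unfolded padic_null_def]] by simp
  then show ?thesis
    unfolding padic_null_def
    by (rule tendsto_sandwich[rotated 3, where f = "\<lambda>_. 0"])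
      (auto intro!: always_eventually padic_abs_triangle assms)
qed

lemma padic_null_mult:
  assumes "prime p" "padic_null p s" "padic_Cauchy p t"
  shows "padic_null p (\<lambda>n. s n * t n)"
proof -
  obtain C where C: "C > 0" "\<And>n. padic_abs p (t n) \<le> C"
    using padic_Cauchy_bounded assms by blast
  have "(\<lambda>n. padic_abs p (s n) * C) \<longlonglongrightarrow> 0"
    using tendsto_mult_right[OF assms(2)[unfolded padic_null_def], of C] by simp
  then show ?thesis
    unfolding padic_null_def
    by (rule tendsto_sandwich[rotated 3, where f = "\<lambda>_. 0"])
      (auto intro!: always_eventually mult_left_mono C simp: padic_abs_mult assms(1))
qed

lemma padic_Cauchy_not_null:
  assumes "prime p" "padic_Cauchy p s" "\<not> padic_null p s"
  obtains c N where "c > 0" "\<And>n. n \<ge> N \<Longrightarrow> padic_abs p (s n) \<ge> c"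
proof -
  obtain e where e: "e > 0" "\<And>N. \<exists>n\<ge>N. padic_abs p (s n) \<ge> e"
    using assms(3) unfolding padic_null_def LIMSEQ_iff by (auto simp: not_less)
  obtain N where N: "\<forall>m\<ge>N. \<forall>n\<ge>N. padic_abs p (s m - s n) < e / 2"
    using padic_CauchyD[OF assms(2), of "e / 2"] e by auto
  obtain k where k: "k \<ge> N" "padic_abs p (s k) \<ge> e" using e by blast
  have "padic_abs p (s n) \<ge> e / 2" if "n \<ge> N" for n
  proof -
    have "padic_abs p (s k - s n) < e / 2" using N k that by blast
    with padic_abs_triangle[OF assms(1), of "s k - s n" "s n"] k show ?thesis by simp
  qed
  with e show ?thesis using that[of "e / 2" N] by simp
qed

lemma padic_Cauchy_inverse:
  assumes "prime p" "padic_Cauchy p s" "\<not> padic_null p s"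
  shows "padic_Cauchy p (\<lambda>n. inverse (s n))"
  unfolding padic_Cauchy_def
proof (intro allI impI)
  fix e :: real assume e: "e > 0"
  obtain c M where c: "c > 0" "\<And>n. n \<ge> M \<Longrightarrow> padic_abs p (s n) \<ge> c"
    using padic_Cauchy_not_null[OF assms] by blast
  obtain N where N: "\<forall>m\<ge>N. \<forall>n\<ge>N. padic_abs p (s m - s n) < e * c\<^sup>2"
    using padic_CauchyD[OF assms(2), of "e * c\<^sup>2"] e c by auto
  have "padic_abs p (inverse (s m) - inverse (s n)) < e" if "m \<ge> max M N" "n \<ge> max M N" for m n
  proof -
    have ge: "padic_abs p (s m) \<ge> c" "padic_abs p (s n) \<ge> c" using c that by auto
    then have nz: "s m \<noteq> 0" "s n \<noteq> 0" using c(1) by auto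
    then have "inverse (s m) - inverse (s n) = (s n - s m) * inverse (s m * s n)"
      by (simp add: field_simps)
    then have "padic_abs p (inverse (s m) - inverse (s n)) =
        padic_abs p (s n - s m) / (padic_abs p (s m) * padic_abs p (s n))"
      using assms(1) by (simp add: padic_abs_mult padic_abs_inverse divide_inverse)
    also have "\<dots> \<le> padic_abs p (s n - s m) / c\<^sup>2"
      unfolding power2_eq_square using ge c(1)
      by (intro divide_left_mono mult_mono mult_pos_pos) auto
    also have "\<dots> < e" using N that c(1) by (simp add: divide_less_eq)
    finally show ?thesis .
  qed
  then show "\<exists>N. \<forall>m\<ge>N. \<forall>n\<ge>N. padic_abs p (inverse (s m) - inverse (s n)) < e" by blast
qed

lemma cring_padic_Cauchy_ring:
  assumes "prime p"
  shows "cring (padic_Cauchy_ring p)"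
proof (rule cringI)
  have "\<exists>t. padic_Cauchy p t \<and> (\<lambda>n. t n + s n) = (\<lambda>_. 0)" if "padic_Cauchy p s" for s
    using padic_Cauchy_mult[OF assms padic_Cauchy_const that, of "- 1"]
    by (intro exI[of _ "\<lambda>n. - 1 * s n"]) simp
  then show "abelian_group (padic_Cauchy_ring p)"
    by (intro abelian_groupI)
      (auto simp: padic_Cauchy_ring_def padic_Cauchy_const padic_Cauchy_add[OF assms] algebra_simps)
  show "comm_monoid (padic_Cauchy_ring p)"
    by (rule comm_monoidI)
      (auto simp: padic_Cauchy_ring_def padic_Cauchy_const padic_Cauchy_mult[OF assms] algebra_simps)
qed (auto simp: padic_Cauchy_ring_def algebra_simps)

lemma ideal_padic_null:
  assumes "prime p"
  shows "ideal {s. padic_null p s} (padic_Cauchy_ring p)"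
proof (rule idealI)
  interpret cring "padic_Cauchy_ring p" by (rule cring_padic_Cauchy_ring) fact
  show "ring (padic_Cauchy_ring p)" by (rule ring_axioms)
  have uminus: "\<ominus>\<^bsub>padic_Cauchy_ring p\<^esub> s = (\<lambda>n. - s n)" if "padic_Cauchy p s" for s
    using padic_Cauchy_mult[OF assms padic_Cauchy_const that, of "- 1"] that
    by (intro minus_equality) (auto simp: padic_Cauchy_ring_def)
  show "subgroup {s. padic_null p s} (add_monoid (padic_Cauchy_ring p))"
  proof (rule add.subgroupI)
    show "{s. padic_null p s} \<subseteq> carrier (padic_Cauchy_ring p)"
      using padic_null_imp_Cauchy[OF assms] by (auto simp: padic_Cauchy_ring_def)
    have "padic_null p (\<lambda>_. 0)" by (simp add: padic_null_def)
    then show "{s. padic_null p s} \<noteq> {}" by blast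
  next
    fix s assume "s \<in> {s. padic_null p s}"
    then show "\<ominus>\<^bsub>padic_Cauchy_ring p\<^esub> s \<in> {s. padic_null p s}"
      using uminus[OF padic_null_imp_Cauchy[OF assms]] assms by (auto simp: padic_null_def)
  qed (auto simp: padic_Cauchy_ring_def padic_null_add[OF assms])
  fix s t assume "s \<in> {s. padic_null p s}" "t \<in> carrier (padic_Cauchy_ring p)"
  then have *: "padic_null p (\<lambda>n. s n * t n)"
    using padic_null_mult[OF assms] by (auto simp: padic_Cauchy_ring_def)
  then show "s \<otimes>\<^bsub>padic_Cauchy_ring p\<^esub> t \<in> {s. padic_null p s}"
    by (simp add: padic_Cauchy_ring_def)
  from * show "t \<otimes>\<^bsub>padic_Cauchy_ring p\<^esub> s \<in> {s. padic_null p s}"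
    by (simp add: padic_Cauchy_ring_def mult.commute)
qed

lemma field_padic_field:
  assumes "prime p"
  shows "field (padic_field p)"
proof -
  let ?R = "padic_Cauchy_ring p" and ?I = "{s. padic_null p s}"
  interpret cring ?R by (rule cring_padic_Cauchy_ring) fact
  interpret ideal ?I ?R by (rule ideal_padic_null) fact
  interpret Q: cring "?R Quot ?I" by (intro quotient_is_cring is_cring)
  have coset_eq: "?I +>\<^bsub>?R\<^esub> s = ?I +>\<^bsub>?R\<^esub> t"
    if s: "padic_Cauchy p s" and t: "padic_Cauchy p t" and "padic_null p (\<lambda>n. s n - t n)" for s t
  proof -
    have "s = (\<lambda>n. s n - t n) \<oplus>\<^bsub>?R\<^esub> t" by (simp add: padic_Cauchy_ring_def)
    with that(3) have "s \<in> ?I +>\<^bsub>?R\<^esub> t" by (auto simp: a_r_coset_def')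
    then show ?thesis
      using a_repr_independence[OF _ _ a_subgroup, of s t] t by (simp add: padic_Cauchy_ring_def)
  qed
  have "field (?R Quot ?I)"
  proof (rule Q.cring_fieldI2)
    show "\<zero>\<^bsub>?R Quot ?I\<^esub> \<noteq> \<one>\<^bsub>?R Quot ?I\<^esub>"
    proof
      assume "\<zero>\<^bsub>?R Quot ?I\<^esub> = \<one>\<^bsub>?R Quot ?I\<^esub>"
      then have "\<one>\<^bsub>?R\<^esub> \<in> ?I"
        by (intro rcos_const_imp_mem) (auto simp: FactRing_def)
      then have "(\<lambda>_::nat. 1::real) \<longlonglongrightarrow> 0" by (simp add: padic_Cauchy_ring_def padic_null_def)
      then show False by (simp add: LIMSEQ_const_iff)
    qed
  next
    fix a assume a: "a \<in> carrier (?R Quot ?I)" "a \<noteq> \<zero>\<^bsub>?R Quot ?I\<^esub>"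
    then obtain s where s: "padic_Cauchy p s" and a_eq: "a = ?I +>\<^bsub>?R\<^esub> s"
      by (auto simp: FactRing_def A_RCOSETS_def' padic_Cauchy_ring_def)
    have "\<not> padic_null p s"
      using a(2) a_eq a_coset_join2[OF _ a_subgroup, of s] s
      by (auto simp: FactRing_def padic_Cauchy_ring_def)
    then obtain c N where c: "c > 0" "\<And>n. n \<ge> N \<Longrightarrow> padic_abs p (s n) \<ge> c"
      using padic_Cauchy_not_null[OF assms s] by blast
    have inv: "padic_Cauchy p (\<lambda>n. inverse (s n))"
      using padic_Cauchy_inverse[OF assms s] \<open>\<not> padic_null p s\<close> .
    have "s n * inverse (s n) - 1 = 0" if "n \<ge> N" for n
      using c(2)[OF that] c(1) by (cases "s n = 0") auto
    then have "padic_null p (\<lambda>n. s n * inverse (s n) - 1)"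
      unfolding padic_null_def
      by (intro tendsto_eventually eventually_sequentiallyI[of N]) (simp del: right_inverse)
    then have "?I +>\<^bsub>?R\<^esub> (\<lambda>n. s n * inverse (s n)) = ?I +>\<^bsub>?R\<^esub> (\<lambda>_. 1)"
      by (intro coset_eq padic_Cauchy_mult[OF assms s inv] padic_Cauchy_const)
    then have "a \<otimes>\<^bsub>?R Quot ?I\<^esub> (?I +>\<^bsub>?R\<^esub> (\<lambda>n. inverse (s n))) = \<one>\<^bsub>?R Quot ?I\<^esub>"
      using s inv rcoset_mult_add[of s "\<lambda>n. inverse (s n)"]
      by (simp add: a_eq FactRing_def padic_Cauchy_ring_def)
    moreover have "?I +>\<^bsub>?R\<^esub> (\<lambda>n. inverse (s n)) \<in> carrier (?R Quot ?I)"
      using inv by (auto simp: FactRing_def A_RCOSETS_def' padic_Cauchy_ring_def)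
    ultimately show "\<exists>b\<in>carrier (?R Quot ?I). a \<otimes>\<^bsub>?R Quot ?I\<^esub> b = \<one>\<^bsub>?R Quot ?I\<^esub>"
      by blast
  qed
  then show ?thesis by (simp add: padic_field_def)
qed

lemma
  assumes "prime p"
  shows padic_of_rat_closed: "padic_of_rat p x \<in> carrier (padic_field p)"
    and padic_of_rat_one: "padic_of_rat p 1 = \<one>\<^bsub>padic_field p\<^esub>"
    and padic_of_rat_add: "padic_of_rat p (x + y) = padic_of_rat p x \<oplus>\<^bsub>padic_field p\<^esub> padic_of_rat p y"
    and padic_of_rat_mult: "padic_of_rat p (x * y) = padic_of_rat p x \<otimes>\<^bsub>padic_field p\<^esub> padic_of_rat p y"
    and padic_of_rat_eq_0_iff: "padic_of_rat p x = \<zero>\<^bsub>padic_field p\<^esub> \<longleftrightarrow> x = 0"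
proof -
  let ?R = "padic_Cauchy_ring p" and ?I = "{s. padic_null p s}"
  interpret cring ?R by (rule cring_padic_Cauchy_ring) fact
  interpret ideal ?I ?R by (rule ideal_padic_null) fact
  have c: "(\<lambda>_. x) \<in> carrier ?R" for x
    by (simp add: padic_Cauchy_ring_def padic_Cauchy_const)
  note h = rcos_ring_hom[folded padic_field_def]
  show "padic_of_rat p x \<in> carrier (padic_field p)"
    unfolding padic_of_rat_def by (rule ring_hom_closed[OF h c])
  show "padic_of_rat p 1 = \<one>\<^bsub>padic_field p\<^esub>"
    using ring_hom_one[OF h] by (simp add: padic_of_rat_def padic_Cauchy_ring_def)
  show "padic_of_rat p (x + y) = padic_of_rat p x \<oplus>\<^bsub>padic_field p\<^esub> padic_of_rat p y"
    using ring_hom_add[OF h c c] by (simp add: padic_of_rat_def padic_Cauchy_ring_def)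
  show "padic_of_rat p (x * y) = padic_of_rat p x \<otimes>\<^bsub>padic_field p\<^esub> padic_of_rat p y"
    using ring_hom_mult[OF h c c] by (simp add: padic_of_rat_def padic_Cauchy_ring_def)
  have "padic_of_rat p x = \<zero>\<^bsub>padic_field p\<^esub> \<longleftrightarrow> (\<lambda>_. x) \<in> ?I"
    using rcos_const_imp_mem[OF c] a_coset_join2[OF c a_subgroup]
    by (auto simp: padic_of_rat_def padic_field_def FactRing_def)
  also have "\<dots> \<longleftrightarrow> x = 0"
    by (simp add: padic_null_def LIMSEQ_const_iff padic_abs_eq_0_iff[OF assms])
  finally show "padic_of_rat p x = \<zero>\<^bsub>padic_field p\<^esub> \<longleftrightarrow> x = 0" .
qed

end

(*
  The symbol at p says whether the form u1 x^2 + u2 y^2 + u3 z^2 is isotropic over Q_p.  For odd p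
  it is given by the tame symbol of a = -u1 u3 and b = -u2 u3, and by the product formula the tame
  symbols of a and b over all odd primes multiply to the dyadic symbol times the real symbol.  The
  real symbol is -1 because the form is positive definite.  At an odd prime p not dividing n, and
  at 2, the equation forces the largest of the p-adic valuations of u1, u2, u3 to be attained at
  least twice; if the third one is smaller, the sum of the unit parts of the two largest is
  divisible by p, and this (at 2: the equation modulo 8) makes the symbol trivial.  So only the primes dividing n and the real
  place remain.  The symbol at 2 enters only through its explicit formula, so no 2-adic quadratic
  form has to be analysed.
*)
theory Submission
  imports Defs "HOL-Number_Theory.Quadratic_Reciprocity"
begin

section \<open>Legendre symbols and supplementary laws\<close>

text \<open>Isotropy is not visibly multiplicative in the coefficients, while the tame and dyadic
  formulas are so by inspection. The product formula is therefore proved for the formulas alone: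
  bilinearity reduces it to the arguments -1, 2 and odd primes, where it amounts to quadratic
  reciprocity and its two supplements. Isotropy is compared with a formula only at odd p, where
  Hensel lifting of square roots suffices. The equation is symmetric in u1, u2, u3, but the pair
  (-u1 u3, -u2 u3) is not. Bilinearity together with f a (-a) = 1 restores the symmetry, so that at
  each place u1 may be taken to have the smallest valuation. Passing from -u1/u3 to -u1 u3
  multiplies by the square u3^2 and makes both arguments integers.\<close>

lemma Legendre_values: "Legendre a p \<in> {-1, 0, 1}"
  by (auto simp: Legendre_def)

lemma Legendre_square_eq_1: "\<not> p dvd a \<Longrightarrow> Legendre a p * Legendre a p = 1"
  by (auto simp: Legendre_def cong_0_iff)

lemma Legendre_eq_1_iff: "\<not> p dvd a \<Longrightarrow> Legendre a p = 1 \<longleftrightarrow> QuadRes p a"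
  by (auto simp: Legendre_def cong_0_iff)

lemma Legendre_1: "\<not> is_unit p \<Longrightarrow> Legendre 1 p = 1"
  by (subst Legendre_eq_1_iff) (auto simp: QuadRes_def intro!: exI[of _ 1])

text \<open>Two elements of {-1, 0, 1} differ by at most 2, which is less than the modulus. This
  turns the congruences of Euler's criterion into equalities.\<close>

lemma sign_cong_imp_eq:
  assumes "[x = y] (mod p)" "x \<in> {-1, 0, 1}" "y \<in> {-1, 0, 1}" "p > (2::int)"
  shows "x = y"
proof (rule ccontr)
  assume "x \<noteq> y"
  moreover have "p dvd \<bar>x - y\<bar>" using assms(1) by (simp add: cong_iff_dvd_diff)
  ultimately have "p \<le> \<bar>x - y\<bar>" by (intro zdvd_imp_le) auto
  then show False using assms by auto
qed

lemma Legendre_mult: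
  assumes "prime p" "2 < p"
  shows "Legendre (a * b) (int p) = Legendre a p * Legendre b p"
proof (rule sign_cong_imp_eq)
  have "[Legendre (a * b) (int p) = (a * b) ^ ((p - 1) div 2)] (mod int p)"
    by (rule euler_criterion[OF assms])
  also have "(a * b) ^ ((p - 1) div 2) = a ^ ((p - 1) div 2) * b ^ ((p - 1) div 2)"
    by (rule power_mult_distrib)
  also have "[a ^ ((p - 1) div 2) * b ^ ((p - 1) div 2) = Legendre a p * Legendre b p] (mod int p)"
    by (intro cong_mult cong_sym[OF euler_criterion[OF assms]])
  finally show "[Legendre (a * b) (int p) = Legendre a p * Legendre b p] (mod int p)" .
  show "Legendre a p * Legendre b p \<in> {-1, 0, 1}"
    using Legendre_values[of a p] Legendre_values[of b p] by auto
qed (use assms Legendre_values in auto)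

text \<open>For odd arguments this is (-1)^((x-1)/2 * (y-1)/2), the sign in quadratic reciprocity.
  Residues modulo 4 make it meaningful for negative arguments too; in particular -1 counts as
  3.\<close>

definition eps4 :: "int \<Rightarrow> int \<Rightarrow> int" where
  "eps4 x y = (if x mod 4 = 3 \<and> y mod 4 = 3 then - 1 else 1)"

lemma Legendre_minus_1:
  assumes "prime p" "2 < p"
  shows "Legendre (- 1) (int p) = eps4 (- 1) (int p)"
proof (rule sign_cong_imp_eq)
  have "odd p" using assms prime_odd_nat by blast
  then have "even ((p - 1) div 2) \<longleftrightarrow> int p mod 4 \<noteq> 3" by presburger
  then have "(- 1 :: int) ^ ((p - 1) div 2) = eps4 (- 1) (int p)" by (auto simp: eps4_def)
  then show "[Legendre (- 1) (int p) = eps4 (- 1) (int p)] (mod int p)"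
    using euler_criterion[OF assms, of "- 1"] by simp
qed (use assms Legendre_values in \<open>auto simp: eps4_def\<close>)

text \<open>For odd x this is (-1)^((x^2-1)/8), the sign in the second supplementary law.\<close>

definition chi8 :: "int \<Rightarrow> int" where
  "chi8 x = (if x mod 8 = 1 \<or> x mod 8 = 7 then 1 else - 1)"

lemma Legendre_2:
  assumes "prime p" "2 < p"
  shows "Legendre 2 (int p) = chi8 (int p)"
proof -
  have "\<not> [2 = 0] (mod int p)"
    using assms(2) zdvd_imp_le[of "int p" 2] by (auto simp: cong_0_iff)
  then interpret GAUSS p 2
    using assms by unfold_locales auto
  define k where "k = (int p - 1) div 2"
  have p_k: "int p = 2 * k + 1" and k: "k \<ge> 1" using p_eq2 assms(2) by (auto simp: k_def)
  have E: "E = (\<lambda>x. 2 * x) ` {k div 2 <.. k}"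
  proof -
    have "E = {y. \<exists>x\<in>{0<..k}. y = (x * 2) mod int p \<and> k < y}"
      by (auto simp: E_def C_def B_def A_def k_def)
    \<comment> \<open>Since 2 x <= 2 k < p, doubling never wraps around, so Gauss's lemma just
      counts the x in the upper half of 1..k.\<close>
    also have "\<dots> = {y. \<exists>x\<in>{0<..k}. y = 2 * x \<and> k < y}"
      using p_k by (auto simp: mod_pos_pos_trivial)
    also have "\<dots> = (\<lambda>x. 2 * x) ` {k div 2 <.. k}"
      using k by (auto simp: image_iff)
    finally show ?thesis .
  qed
  have "card E = card {k div 2 <.. k}"
    unfolding E by (rule card_image) (auto simp: inj_on_def)
  then have card: "card E = nat (k - k div 2)" by simp
  have "Legendre 2 (int p) = (- 1) ^ nat (k - k div 2)"
    using gauss_lemma card by simp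
  also have "\<dots> = (if even (k - k div 2) then 1 else - 1)"
    using k by (auto simp: even_nat_iff)
  also have "\<dots> = chi8 (int p)"
  proof -
    \<comment> \<open>Both sides say that k is 0 or 3 modulo 4.\<close>
    have "even (k - k div 2) \<longleftrightarrow> (2 * k + 1) mod 8 = 1 \<or> (2 * k + 1) mod 8 = 7"
      by presburger
    then show ?thesis by (simp add: chi8_def p_k)
  qed
  finally show ?thesis .
qed

lemma odd_mod_8_cases:
  assumes "odd (x::int)"
  obtains "x mod 8 = 1" | "x mod 8 = 3" | "x mod 8 = 5" | "x mod 8 = 7"
proof -
  have "x mod 8 = 1 \<or> x mod 8 = 3 \<or> x mod 8 = 5 \<or> x mod 8 = 7" using assms by presburger
  then show ?thesis using that by blast
qed

lemma odd_mod_4_cases: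
  assumes "odd (x::int)"
  obtains "x mod 4 = 1" | "x mod 4 = 3"
proof -
  have "x mod 4 = 1 \<or> x mod 4 = 3" using assms by presburger
  then show ?thesis using that by blast
qed

lemma eps4_mult:
  assumes "odd x" "odd y" "odd z"
  shows "eps4 (x * y) z = eps4 x z * eps4 y z"
proof -
  have "(x * y) mod 4 = ((x mod 4) * (y mod 4)) mod 4" by (simp add: mod_simps)
  with assms show ?thesis
    by (elim odd_mod_4_cases) (simp_all add: eps4_def)
qed

lemma chi8_mult:
  assumes "odd x" "odd y"
  shows "chi8 (x * y) = chi8 x * chi8 y"
proof -
  have "(x * y) mod 8 = ((x mod 8) * (y mod 8)) mod 8" by (simp add: mod_simps)
  with assms show ?thesis
    by (elim odd_mod_8_cases) (simp_all add: chi8_def)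
qed

lemma eps4_commute: "eps4 x y = eps4 y x"
  by (simp add: eps4_def conj_commute)

section \<open>The product formula\<close>

definition unit_part :: "int \<Rightarrow> int \<Rightarrow> int" where
  "unit_part p x = x div p ^ multiplicity p x"

lemma unit_part_eq: "x = p ^ multiplicity p x * unit_part p x"
  by (simp add: unit_part_def multiplicity_dvd)

lemma
  assumes "prime p" "\<not> p dvd y"
  shows multiplicity_decomposed: "multiplicity p (p ^ k * y) = k"
    and unit_part_decomposed: "unit_part p (p ^ k * y) = y"
proof -
  have "p \<noteq> 0" using assms by auto
  then show m: "multiplicity p (p ^ k * y) = k"
    using multiplicity_decomposeI[OF refl assms(2)] by blast
  show "unit_part p (p ^ k * y) = y"
    using \<open>p \<noteq> 0\<close> by (simp add: unit_part_def m)
qed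

lemma not_dvd_unit_part: "prime p \<Longrightarrow> x \<noteq> 0 \<Longrightarrow> \<not> p dvd unit_part p x"
  unfolding unit_part_def by (rule multiplicity_decompose) auto

lemma multiplicity_mult:
  "prime (p::int) \<Longrightarrow> x \<noteq> 0 \<Longrightarrow> y \<noteq> 0 \<Longrightarrow> multiplicity p (x * y) = multiplicity p x + multiplicity p y"
  by (rule prime_elem_multiplicity_mult_distrib) auto

lemma unit_part_mult:
  assumes "prime p" "x \<noteq> 0" "y \<noteq> 0"
  shows "unit_part p (x * y) = unit_part p x * unit_part p y"
proof -
  have "x * y = p ^ (multiplicity p x + multiplicity p y) * (unit_part p x * unit_part p y)"
    using unit_part_eq[of x p] unit_part_eq[of y p] by (simp add: power_add) (metis mult.assoc mult.left_commute)
  moreover have "\<not> p dvd unit_part p x * unit_part p y"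
    using assms not_dvd_unit_part by (auto simp: prime_dvd_mult_iff)
  ultimately show ?thesis using unit_part_decomposed[OF assms(1)] by metis
qed

lemma multiplicity_minus [simp]: "multiplicity p (- x :: int) = multiplicity p x"
  using multiplicity_times_unit_right[of "- 1" p x] by simp

lemma unit_part_minus [simp]: "unit_part p (- x) = - unit_part p x"
  by (simp add: unit_part_def dvd_neg_div multiplicity_dvd)

lemma unit_part_1 [simp]: "unit_part p 1 = 1"
  by (simp add: unit_part_def)

lemma unit_part_not_dvd: "\<not> p dvd x \<Longrightarrow> unit_part p x = x"
  by (simp add: unit_part_def not_dvd_imp_multiplicity_0)

text \<open>This is the Legendre symbol of (-1)^(i j) a^j / b^i, a p-adic unit, where i and j are
  the valuations of a and b. The quotient of the unit parts becomes a product because Legendre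
  symbols of units are signs.\<close>

definition tame_symbol :: "nat \<Rightarrow> int \<Rightarrow> int \<Rightarrow> int" where
  "tame_symbol p a b =
     Legendre (- 1) p ^ (multiplicity (int p) a * multiplicity (int p) b)
     * Legendre (unit_part p a) p ^ multiplicity (int p) b
     * Legendre (unit_part p b) p ^ multiplicity (int p) a"

text \<open>The classical closed formula for the Hilbert symbol over the 2-adic numbers.\<close>

definition dyadic_symbol :: "int \<Rightarrow> int \<Rightarrow> int" where
  "dyadic_symbol a b = eps4 (unit_part 2 a) (unit_part 2 b)
     * chi8 (unit_part 2 a) ^ multiplicity 2 b * chi8 (unit_part 2 b) ^ multiplicity 2 a"

definition real_symbol :: "int \<Rightarrow> int \<Rightarrow> int" where
  "real_symbol a b = (if a < 0 \<and> b < 0 then - 1 else 1)"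

text \<open>The formal behaviour common to the tame and dyadic symbols, so that reduction modulo
  squares and permutation of the three coefficients are argued once for all places.
  \<open>square_1\<close> expresses that the values are signs.\<close>

locale symbol =
  fixes f :: "int \<Rightarrow> int \<Rightarrow> int"
  assumes commute: "f a b = f b a"
    and mult_left: "a \<noteq> 0 \<Longrightarrow> b \<noteq> 0 \<Longrightarrow> c \<noteq> 0 \<Longrightarrow> f (a * b) c = f a c * f b c"
    and self_minus: "a \<noteq> 0 \<Longrightarrow> f a (- a) = 1"
    and square_1: "a \<noteq> 0 \<Longrightarrow> b \<noteq> 0 \<Longrightarrow> f a b * f a b = 1"
begin

lemma mult_right: "a \<noteq> 0 \<Longrightarrow> b \<noteq> 0 \<Longrightarrow> c \<noteq> 0 \<Longrightarrow> f c (a * b) = f c a * f c b"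
  using mult_left commute by metis

lemma one_left: "b \<noteq> 0 \<Longrightarrow> f 1 b = 1"
  using mult_left[of 1 1 b] square_1[of 1 b] by simp

lemma mult_square_left:
  "a \<noteq> 0 \<Longrightarrow> b \<noteq> 0 \<Longrightarrow> c \<noteq> 0 \<Longrightarrow> f (a * c\<^sup>2) b = f a b"
  using mult_left[of a "c * c" b] mult_left[of c c b] square_1[of c b]
  by (simp add: power2_eq_square)

lemma mult_square_right:
  "a \<noteq> 0 \<Longrightarrow> b \<noteq> 0 \<Longrightarrow> c \<noteq> 0 \<Longrightarrow> f a (b * c\<^sup>2) = f a b"
  using mult_square_left commute by metis

text \<open>
  Together with \<open>commute\<close>, this shows that the symbol attached to the form
  \<open>a x\<^sup>2 + b y\<^sup>2 + c z\<^sup>2\<close> is invariant under all permutations of \<open>a\<close>, \<open>b\<close>, \<open>c\<close>.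
\<close>

lemma ternary_swap:
  assumes "a \<noteq> 0" "b \<noteq> 0" "c \<noteq> 0"
  shows "f (- (a * c)) (- (b * c)) = f (- (c * a)) (- (b * a))"
proof -
  let ?x = "- (a * c)"
  have nz: "?x \<noteq> 0" "- (b * c) \<noteq> 0" "- (b * a) \<noteq> 0" using assms by auto
  \<comment> \<open>With x = - (a * c), the two candidates for the second argument multiply to b^2
    times -x. As f x (- x) = 1 and squares count as 1, f x has the same sign on both.\<close>
  have "- (b * c) * - (b * a) = (b * b) * - ?x" by (simp add: algebra_simps)
  then have "f ?x (- (b * c)) * f ?x (- (b * a)) = f ?x ((b * b) * - ?x)"
    by (metis mult_right[OF nz(2,3,1)])
  also have "\<dots> = f ?x (b * b) * f ?x (- ?x)"
    using assms nz by (intro mult_right) auto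
  also have "\<dots> = 1"
    using self_minus[OF nz(1)] mult_right[OF assms(2,2) nz(1)] square_1[OF nz(1) assms(2)] by simp
  finally have "f ?x (- (b * c)) = f ?x (- (b * a))"
    using square_1[OF nz(1,3)] by (metis mult.assoc mult.commute mult_1)
  then show ?thesis by (simp add: mult.commute)
qed

end

lemma symbol_tame_symbol:
  assumes "prime p" "2 < p"
  shows "symbol (tame_symbol p)"
proof
  have prime: "prime (int p)" using assms by simp
  have L1: "Legendre (- 1) p * Legendre (- 1) p = 1"
    using prime by (intro Legendre_square_eq_1) auto
  have L: "Legendre (unit_part p a) p * Legendre (unit_part p a) p = 1" if "a \<noteq> 0" for a
    using prime that by (intro Legendre_square_eq_1 not_dvd_unit_part)
  show "tame_symbol p a b = tame_symbol p b a" for a b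
    by (simp add: tame_symbol_def mult_ac)
  show "tame_symbol p (a * b) c = tame_symbol p a c * tame_symbol p b c"
    if "a \<noteq> 0" "b \<noteq> 0" "c \<noteq> 0" for a b c
    using that prime
    by (simp add: tame_symbol_def multiplicity_mult unit_part_mult Legendre_mult[OF assms]
        distrib_left distrib_right power_add power_mult_distrib mult_ac)
  show "tame_symbol p a (- a) = 1" if "a \<noteq> 0" for a
  proof -
    let ?k = "multiplicity (int p) a"
    have "Legendre (- unit_part p a) p = Legendre (- 1) p * Legendre (unit_part p a) p"
      using Legendre_mult[OF assms, of "- 1" "unit_part p a"] by simp
    \<comment> \<open>The symbol of -1 enters k * k times by definition and k more times through the
      unit part of \<open>- a\<close>.\<close>
    then have "tame_symbol p a (- a) = Legendre (- 1) p ^ (?k * ?k + ?k) *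
        (Legendre (unit_part p a) p * Legendre (unit_part p a) p) ^ ?k"
      by (simp add: tame_symbol_def power_add power_mult_distrib mult_ac)
    also have "even (?k * ?k + ?k)" by simp
    then obtain m where "?k * ?k + ?k = 2 * m" by blast
    then have "Legendre (- 1) p ^ (?k * ?k + ?k) = 1"
      using L1 by (simp add: power_mult power2_eq_square)
    finally show ?thesis using L[OF that] by simp
  qed
  show "tame_symbol p a b * tame_symbol p a b = 1" if "a \<noteq> 0" "b \<noteq> 0" for a b
  proof -
    have "tame_symbol p a b * tame_symbol p a b =
      (Legendre (- 1) p * Legendre (- 1) p) ^ (multiplicity (int p) a * multiplicity (int p) b)
     * (Legendre (unit_part p a) p * Legendre (unit_part p a) p) ^ multiplicity (int p) b
     * (Legendre (unit_part p b) p * Legendre (unit_part p b) p) ^ multiplicity (int p) a"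
      by (simp add: tame_symbol_def power_mult_distrib mult_ac)
    then show ?thesis using L1 L that by simp
  qed
qed

lemma symbol_dyadic_symbol: "symbol dyadic_symbol"
proof
  have odd: "odd (unit_part 2 a)" if "a \<noteq> 0" for a
    using that by (intro not_dvd_unit_part) auto
  have chi: "chi8 x * chi8 x = 1" and eps: "eps4 x y * eps4 x y = 1" for x y
    by (simp_all add: chi8_def eps4_def)
  show "dyadic_symbol a b = dyadic_symbol b a" for a b
    by (simp add: dyadic_symbol_def eps4_commute mult_ac)
  show "dyadic_symbol (a * b) c = dyadic_symbol a c * dyadic_symbol b c"
    if "a \<noteq> 0" "b \<noteq> 0" "c \<noteq> 0" for a b c
    using that odd
    by (simp add: dyadic_symbol_def multiplicity_mult unit_part_mult chi8_mult eps4_mult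
        power_add power_mult_distrib mult_ac)
  show "dyadic_symbol a (- a) = 1" if "a \<noteq> 0" for a
  proof -
    let ?u = "unit_part 2 a"
    \<comment> \<open>Of an odd number and its negative exactly one is 3 modulo 4, and
      \<open>chi8\<close> is an even function.\<close>
    have "eps4 ?u (- ?u) = 1" using odd[OF that] unfolding eps4_def by presburger
    moreover have "chi8 (- ?u) = chi8 ?u" using odd[OF that] unfolding chi8_def by presburger
    ultimately show ?thesis
      using chi[of ?u] by (simp add: dyadic_symbol_def flip: power_mult_distrib)
  qed
  show "dyadic_symbol a b * dyadic_symbol a b = 1" for a b
  proof -
    have "dyadic_symbol a b * dyadic_symbol a b =
      (eps4 (unit_part 2 a) (unit_part 2 b) * eps4 (unit_part 2 a) (unit_part 2 b))
     * (chi8 (unit_part 2 a) * chi8 (unit_part 2 a)) ^ multiplicity 2 b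
     * (chi8 (unit_part 2 b) * chi8 (unit_part 2 b)) ^ multiplicity 2 a"
      by (simp add: dyadic_symbol_def power_mult_distrib mult_ac)
    then show ?thesis using chi eps by simp
  qed
qed

lemma real_symbol_mult:
  "a \<noteq> 0 \<Longrightarrow> b \<noteq> 0 \<Longrightarrow> real_symbol (a * b) c = real_symbol a c * real_symbol b c"
  by (auto simp: real_symbol_def mult_less_0_iff)

lemma tame_symbol_eq_1:
  assumes "\<not> int p dvd a" "\<not> int p dvd b"
  shows "tame_symbol p a b = 1"
  using assms by (simp add: tame_symbol_def not_dvd_imp_multiplicity_0)

lemma prod_eq_single:
  assumes "finite S" "q \<in> S" "\<And>p. p \<in> S \<Longrightarrow> p \<noteq> q \<Longrightarrow> g p = 1"
  shows "(\<Prod>p\<in>S. g p) = g q"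
  using assms by (simp add: prod.remove)

lemma prod_eq_pair:
  assumes "finite S" "q \<in> S" "r \<in> S" "q \<noteq> r" "\<And>p. p \<in> S \<Longrightarrow> p \<noteq> q \<Longrightarrow> p \<noteq> r \<Longrightarrow> g p = 1"
  shows "(\<Prod>p\<in>S. g p) = g q * g r"
proof -
  have "prod g S = g q * prod g (S - {q})" using assms(1,2) by (rule prod.remove)
  also have "prod g (S - {q}) = g r" using assms by (intro prod_eq_single) auto
  finally show ?thesis .
qed

lemma Quadratic_Reciprocity_eps4:
  assumes "prime p" "2 < p" "prime q" "2 < q" "p \<noteq> q"
  shows "Legendre p q * Legendre q p = eps4 (int p) (int q)"
proof -
  have "odd p" "odd q" using assms prime_odd_nat by blast+
  then have "even ((p - 1) div 2) \<longleftrightarrow> int p mod 4 \<noteq> 3" "even ((q - 1) div 2) \<longleftrightarrow> int q mod 4 \<noteq> 3"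
    by presburger+
  then have "(- 1 :: int) ^ ((p - 1) div 2 * ((q - 1) div 2)) = eps4 (int p) (int q)"
    by (auto simp: eps4_def)
  then show ?thesis using Quadratic_Reciprocity[OF assms] by simp
qed

section \<open>The product formula over a finite set of odd primes, 2 and the real place\<close>

context
  fixes S :: "nat set"
  assumes finite: "finite S" and odd_primes: "\<And>p. p \<in> S \<Longrightarrow> prime p \<and> 2 < p"
begin

text \<open>An odd prime dividing neither argument contributes 1, so a finite \<open>S\<close> can
  stand for all odd places. It is fixed independently of the arguments, so that bilinearity passes
  through the product.\<close>

definition total_symbol :: "int \<Rightarrow> int \<Rightarrow> int" where
  "total_symbol a b = (\<Prod>p\<in>S. tame_symbol p a b) * dyadic_symbol a b * real_symbol a b"

lemma total_symbol_commute: "total_symbol a b = total_symbol b a"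
proof -
  have "(\<Prod>p\<in>S. tame_symbol p a b) = (\<Prod>p\<in>S. tame_symbol p b a)"
    using odd_primes symbol_tame_symbol by (intro prod.cong refl symbol.commute) auto
  then show ?thesis
    using symbol.commute[OF symbol_dyadic_symbol, of a b]
    by (simp add: total_symbol_def real_symbol_def conj_commute)
qed

lemma total_symbol_mult:
  assumes "a \<noteq> 0" "b \<noteq> 0" "c \<noteq> 0"
  shows "total_symbol (a * b) c = total_symbol a c * total_symbol b c"
proof -
  have "(\<Prod>p\<in>S. tame_symbol p (a * b) c) = (\<Prod>p\<in>S. tame_symbol p a c * tame_symbol p b c)"
    using odd_primes symbol_tame_symbol assms by (intro prod.cong refl symbol.mult_left) auto
  then show ?thesis
    using assms by (simp add: total_symbol_def prod.distrib real_symbol_mult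
        symbol.mult_left[OF symbol_dyadic_symbol] mult_ac)
qed

lemma total_symbol_one: "b \<noteq> 0 \<Longrightarrow> total_symbol 1 b = 1"
  using odd_primes by (simp add: total_symbol_def real_symbol_def
      symbol.one_left[OF symbol_dyadic_symbol] symbol.one_left[OF symbol_tame_symbol])

text \<open>Each kind of pair is one classical law: -1 or 2 against q gives the supplementary laws,
  distinct odd primes give quadratic reciprocity, and q against itself gives the law for -1
  again.\<close>

lemma total_symbol_generators:
  assumes a: "a \<in> insert (- 1) (insert 2 (int ` S))" and b: "b \<in> insert (- 1) (insert 2 (int ` S))"
  shows "total_symbol a b = 1"
proof -
  have u2: "unit_part 2 2 = 1" "multiplicity 2 (2::int) = 1"
    using unit_part_decomposed[of 2 1 1] by simp_all
  \<comment> \<open>The value -1 at (-1, -1) is cancelled by the real symbol; this is the only pair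
    of generators that is negative in both places.\<close>
  have d: "dyadic_symbol (- 1) (- 1) = - 1" "dyadic_symbol (- 1) 2 = 1"
    "dyadic_symbol 2 (- 1) = 1" "dyadic_symbol 2 2 = 1"
    by (simp_all add: dyadic_symbol_def u2 eps4_def chi8_def)
  have odd: "odd q" if "q \<in> S" for q
    using odd_primes[OF that] prime_odd_nat by blast
  have nd: "\<not> int p dvd 2" "\<not> int p dvd - 1" "\<not> int p dvd 1" if "p \<in> S" for p
    using odd_primes[OF that] zdvd_imp_le[of "int p" 2] by auto
  have ndq: "\<not> int p dvd int q" if "p \<in> S" "q \<in> S" "p \<noteq> q" for p q
    using odd_primes[OF that(1)] odd_primes[OF that(2)] that(3) primes_dvd_imp_eq[of p q] by auto
  have uq: "unit_part 2 (int q) = int q" "multiplicity 2 (int q) = 0"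
    "unit_part q (int q) = 1" "multiplicity (int q) (int q) = 1" if "q \<in> S" for q
    using odd[OF that] odd_primes[OF that] unit_part_decomposed[of "int q" 1 1] nd(3)[OF that]
    by (auto simp: unit_part_not_dvd not_dvd_imp_multiplicity_0)
  have tq: "tame_symbol q x (int q) = Legendre x q" if "q \<in> S" "\<not> int q dvd x" for q x
    using that uq(3,4)[OF that(1)]
    by (simp add: tame_symbol_def not_dvd_imp_multiplicity_0 unit_part_not_dvd)
  have units: "total_symbol x y = 1" if "x \<in> {-1, 2}" "y \<in> {-1, 2}" for x y
  proof -
    have "(\<Prod>p\<in>S. tame_symbol p x y) = 1"
      using that nd by (intro prod.neutral ballI tame_symbol_eq_1) auto
    then show ?thesis using that by (auto simp: total_symbol_def real_symbol_def d)
  qed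
  have mixed: "total_symbol x (int q) = 1" if "x \<in> {-1, 2}" "q \<in> S" for x q
  proof -
    have "(\<Prod>p\<in>S. tame_symbol p x (int q)) = tame_symbol q x (int q)"
      using that nd ndq by (intro prod_eq_single finite tame_symbol_eq_1) auto
    also have "\<dots> = Legendre x q" using that nd by (intro tq) auto
    finally have *: "(\<Prod>p\<in>S. tame_symbol p x (int q)) = Legendre x q" .
    have "Legendre x q * dyadic_symbol x (int q) = 1"
      using that(1)
    proof safe
      show "Legendre (- 1) q * dyadic_symbol (- 1) (int q) = 1"
        using odd_primes[OF that(2)]
        by (simp add: Legendre_minus_1 dyadic_symbol_def uq[OF that(2)])
          (simp add: eps4_def)
      show "Legendre 2 q * dyadic_symbol 2 (int q) = 1"
        using odd_primes[OF that(2)]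
        by (simp add: Legendre_2 dyadic_symbol_def uq[OF that(2)] u2)
          (simp add: eps4_def chi8_def)
    qed
    then show ?thesis by (simp add: total_symbol_def * real_symbol_def)
  qed
  have primes: "total_symbol (int q) (int r) = 1" if "q \<in> S" "r \<in> S" for q r
  proof (cases "q = r")
    case True
    have "(\<Prod>p\<in>S. tame_symbol p (int q) (int q)) = tame_symbol q (int q) (int q)"
      using that ndq by (intro prod_eq_single finite tame_symbol_eq_1) auto
    \<comment> \<open>The unit part of q is 1, so only the sign factor survives; it cancels the
      dyadic value \<open>eps4 (int q) (int q)\<close>.\<close>
    also have "\<dots> = Legendre (- 1) q"
      using Legendre_1[OF nd(3)[OF that(1)]] by (simp add: tame_symbol_def uq[OF that(1)])
    finally show ?thesis
      using odd_primes[OF that(1)] True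
      by (simp add: total_symbol_def Legendre_minus_1 real_symbol_def dyadic_symbol_def
          uq[OF that(2)]) (simp add: eps4_def)
  next
    case False
    have "(\<Prod>p\<in>S. tame_symbol p (int q) (int r)) =
        tame_symbol q (int q) (int r) * tame_symbol r (int q) (int r)"
  proof (rule prod_eq_pair[OF finite that False])
    show "tame_symbol p (int q) (int r) = 1" if "p \<in> S" "p \<noteq> q" "p \<noteq> r" for p
      using that ndq \<open>q \<in> S\<close> \<open>r \<in> S\<close> by (intro tame_symbol_eq_1)
  qed
    also have "tame_symbol q (int q) (int r) = tame_symbol q (int r) (int q)"
      using symbol.commute[OF symbol_tame_symbol] odd_primes[OF that(1)] by blast
    also have "tame_symbol q (int r) (int q) * tame_symbol r (int q) (int r) =
        Legendre r q * Legendre q r"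
      using that ndq False by (simp add: tq)
    also have "\<dots> = eps4 (int r) (int q)"
      using odd_primes that False by (intro Quadratic_Reciprocity_eps4) auto
    finally show ?thesis
      by (simp add: total_symbol_def real_symbol_def dyadic_symbol_def uq[OF that(1)] uq[OF that(2)])
        (simp add: eps4_def)
  qed
  have mixed': "total_symbol (int q) x = 1" if "x \<in> {-1, 2}" "q \<in> S" for x q
    using mixed[OF that] by (subst total_symbol_commute)
  consider "a \<in> {-1, 2}" | q where "a = int q" "q \<in> S" using a by blast
  moreover consider "b \<in> {-1, 2}" | r where "b = int r" "r \<in> S" using b by blast
  ultimately show ?thesis by cases (metis units mixed mixed' primes)+
qed

text \<open>Bilinearity along the factorization of a into primes and a sign. The second argument is
  kept arbitrary because the induction is run once for each argument.\<close>

lemma total_symbol_induct: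
  assumes gen: "\<And>g. g \<in> insert (- 1) (insert 2 (int ` S)) \<Longrightarrow> total_symbol g b = 1"
    and "a \<noteq> 0" "b \<noteq> 0" "\<And>p. prime p \<Longrightarrow> int p dvd a \<Longrightarrow> p = 2 \<or> p \<in> S"
  shows "total_symbol a b = 1"
  using assms(2-)
proof (induction a rule: prime_divisors_induct)
  case (unit x)
  then have "x = 1 \<or> x = - 1" by auto
  then show ?case using total_symbol_one[OF \<open>b \<noteq> 0\<close>] gen by auto
next
  case (factor q x)
  have q: "prime (nat q)" "int (nat q) = q" using factor.hyps prime_ge_0_int by auto
  then have "nat q = 2 \<or> nat q \<in> S" by (intro factor.prems(3)) simp_all
  then have "q \<in> insert (- 1) (insert 2 (int ` S))"
    using q(2) by (metis imageI insertI1 insertI2 of_nat_numeral)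
  then have "total_symbol q b = 1" by (rule gen)
  moreover have "total_symbol x b = 1"
    using factor.prems by (intro factor.IH) auto
  ultimately show ?case
    using factor.prems factor.hyps by (subst total_symbol_mult) auto
qed simp

lemma hilbert_reciprocity:
  assumes "a \<noteq> 0" "b \<noteq> 0"
    and "\<And>p. prime p \<Longrightarrow> int p dvd a \<Longrightarrow> p = 2 \<or> p \<in> S"
    and "\<And>p. prime p \<Longrightarrow> int p dvd b \<Longrightarrow> p = 2 \<or> p \<in> S"
  shows "total_symbol a b = 1"
proof (rule total_symbol_induct)
  fix g assume g: "g \<in> insert (- 1) (insert 2 (int ` S))"
  then have "g \<noteq> 0" using odd_primes by force
  \<comment> \<open>Here b is decomposed while the generator g stays fixed; the enclosing rule then
    decomposes a.\<close>
  have "total_symbol b g = 1"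
    using total_symbol_generators[OF _ g] assms(2) \<open>g \<noteq> 0\<close> assms(4) by (rule total_symbol_induct)
  then show "total_symbol g b = 1" by (subst total_symbol_commute)
qed (use assms in auto)

end


section \<open>Isotropy over the p-adic numbers\<close>

text \<open>Solvability over the p-adic field expressed by representing sequences: equality in the
  quotient becomes a null difference. All later arguments thus stay with rational numbers.\<close>

definition isotropic :: "nat \<Rightarrow> rat \<Rightarrow> rat \<Rightarrow> bool" where
  "isotropic p a b \<longleftrightarrow> (\<exists>x y z. padic_Cauchy p x \<and> padic_Cauchy p y \<and> padic_Cauchy p z \<and>
     \<not> (padic_null p x \<and> padic_null p y \<and> padic_null p z) \<and>
     padic_null p (\<lambda>n. z n ^ 2 - a * x n ^ 2 - b * y n ^ 2))"

lemma isotropicI: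
  assumes "padic_Cauchy p x" "padic_Cauchy p y" "padic_Cauchy p z"
    and "\<not> (padic_null p x \<and> padic_null p y \<and> padic_null p z)"
    and "padic_null p (\<lambda>n. z n ^ 2 - a * x n ^ 2 - b * y n ^ 2)"
  shows "isotropic p a b"
  using assms unfolding isotropic_def by blast

lemma hilbert_symbol_eq_isotropic:
  assumes "prime p"
  shows "hilbert_symbol p (padic_of_rat p a) (padic_of_rat p b) = (if isotropic p a b then 1 else - 1)"
proof -
  let ?R = "padic_Cauchy_ring p" and ?I = "{s. padic_null p s}"
  interpret cring ?R by (rule cring_padic_Cauchy_ring) fact
  interpret ideal ?I ?R by (rule ideal_padic_null) fact
  interpret K: field "padic_field p" by (rule field_padic_field) fact
  define c where "c s = ?I +>\<^bsub>?R\<^esub> s" for s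
  have h: "c \<in> ring_hom ?R (padic_field p)"
    using rcos_ring_hom[folded padic_field_def] by (simp add: c_def[abs_def])
  have carrier: "s \<in> carrier ?R \<longleftrightarrow> padic_Cauchy p s" for s
    by (simp add: padic_Cauchy_ring_def)
  have carrier_K: "carrier (padic_field p) = c ` {s. padic_Cauchy p s}"
    by (auto simp: padic_field_def FactRing_def A_RCOSETS_def' padic_Cauchy_ring_def c_def)
  have zero: "c s = \<zero>\<^bsub>padic_field p\<^esub> \<longleftrightarrow> padic_null p s" if "padic_Cauchy p s" for s
    using rcos_const_imp_mem[of s] a_coset_join2[OF _ a_subgroup, of s] that
    by (auto simp: padic_field_def FactRing_def carrier c_def)
  have mult: "c (\<lambda>n. s n * t n) = c s \<otimes>\<^bsub>padic_field p\<^esub> c t"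
    if "padic_Cauchy p s" "padic_Cauchy p t" for s t
    using ring_hom_mult[OF h, of s t] that by (simp add: padic_Cauchy_ring_def)
  have add: "c (\<lambda>n. s n + t n) = c s \<oplus>\<^bsub>padic_field p\<^esub> c t"
    if "padic_Cauchy p s" "padic_Cauchy p t" for s t
    using ring_hom_add[OF h, of s t] that by (simp add: padic_Cauchy_ring_def)
  have C_mult: "padic_Cauchy p (\<lambda>n. s n * t n)"
    if "padic_Cauchy p s" "padic_Cauchy p t" for s t
    using padic_Cauchy_mult[OF assms that] .
  have C_add: "padic_Cauchy p (\<lambda>n. s n + t n)"
    if "padic_Cauchy p s" "padic_Cauchy p t" for s t
    using padic_Cauchy_add[OF assms that] .
  have closed: "c s \<in> carrier (padic_field p)" if "padic_Cauchy p s" for s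
    using that carrier_K by blast
  have key: "c z [^]\<^bsub>padic_field p\<^esub> (2::nat) =
      padic_of_rat p a \<otimes>\<^bsub>padic_field p\<^esub> c x [^]\<^bsub>padic_field p\<^esub> (2::nat) \<oplus>\<^bsub>padic_field p\<^esub>
      padic_of_rat p b \<otimes>\<^bsub>padic_field p\<^esub> c y [^]\<^bsub>padic_field p\<^esub> (2::nat)
      \<longleftrightarrow> padic_null p (\<lambda>n. z n ^ 2 - a * x n ^ 2 - b * y n ^ 2)" (is "?l = ?r \<longleftrightarrow> _")
    if x: "padic_Cauchy p x" and y: "padic_Cauchy p y" and z: "padic_Cauchy p z" for x y z
  proof -
    have sq: "c s [^]\<^bsub>padic_field p\<^esub> (2::nat) = c (\<lambda>n. s n * s n)" if "padic_Cauchy p s" for s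
      using closed[OF that] mult[OF that that] by (simp add: numeral_2_eq_2)
    define rhs where "rhs = (\<lambda>n. a * (x n * x n) + b * (y n * y n))"
    note C = padic_Cauchy_const C_mult C_add x y z
    have rhs: "?r = c rhs"
      unfolding sq[OF x] sq[OF y] padic_of_rat_def c_def[symmetric] rhs_def
      by (simp add: add mult C)
    have "padic_Cauchy p rhs" unfolding rhs_def by (intro C)
    \<comment> \<open>The difference is written with the factor -1 so that closure under constants,
      products and sums covers it.\<close>
    define d where "d = (\<lambda>n. z n * z n + - 1 * rhs n)"
    have d: "padic_Cauchy p d" unfolding d_def by (intro C \<open>padic_Cauchy p rhs\<close>)
    have "?l = c (\<lambda>n. d n + rhs n)" by (simp add: sq[OF z] d_def)
    also have "\<dots> = c d \<oplus>\<^bsub>padic_field p\<^esub> c rhs" by (rule add) fact+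
    finally have "?l = ?r \<longleftrightarrow> c d = \<zero>\<^bsub>padic_field p\<^esub>"
      using closed[OF d] closed[OF \<open>padic_Cauchy p rhs\<close>] rhs by simp
    also have "\<dots> \<longleftrightarrow> padic_null p d" by (rule zero) fact
    also have "d = (\<lambda>n. z n ^ 2 - a * x n ^ 2 - b * y n ^ 2)"
      by (simp add: d_def rhs_def power2_eq_square fun_eq_iff)
    finally show ?thesis .
  qed
  have "(\<exists>x\<in>carrier (padic_field p). \<exists>y\<in>carrier (padic_field p). \<exists>z\<in>carrier (padic_field p).
     (x, y, z) \<noteq> (\<zero>\<^bsub>padic_field p\<^esub>, \<zero>\<^bsub>padic_field p\<^esub>, \<zero>\<^bsub>padic_field p\<^esub>) \<and>
     z [^]\<^bsub>padic_field p\<^esub> (2::nat) =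
     padic_of_rat p a \<otimes>\<^bsub>padic_field p\<^esub> x [^]\<^bsub>padic_field p\<^esub> (2::nat) \<oplus>\<^bsub>padic_field p\<^esub>
     padic_of_rat p b \<otimes>\<^bsub>padic_field p\<^esub> y [^]\<^bsub>padic_field p\<^esub> (2::nat)) \<longleftrightarrow>
     (\<exists>x y z. padic_Cauchy p x \<and> padic_Cauchy p y \<and> padic_Cauchy p z \<and>
     (c x, c y, c z) \<noteq> (\<zero>\<^bsub>padic_field p\<^esub>, \<zero>\<^bsub>padic_field p\<^esub>, \<zero>\<^bsub>padic_field p\<^esub>) \<and>
     c z [^]\<^bsub>padic_field p\<^esub> (2::nat) =
     padic_of_rat p a \<otimes>\<^bsub>padic_field p\<^esub> c x [^]\<^bsub>padic_field p\<^esub> (2::nat) \<oplus>\<^bsub>padic_field p\<^esub>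
     padic_of_rat p b \<otimes>\<^bsub>padic_field p\<^esub> c y [^]\<^bsub>padic_field p\<^esub> (2::nat))"
    unfolding carrier_K by blast
  also have "\<dots> \<longleftrightarrow> isotropic p a b"
    unfolding isotropic_def by (intro ex_cong1 conj_cong refl) (simp_all add: key zero)
  finally show ?thesis by (simp add: hilbert_symbol_def Let_def)
qed

lemma padic_null_const_mult:
  assumes "prime p" "padic_null p s"
  shows "padic_null p (\<lambda>n. c * s n)"
  using padic_null_mult[OF assms padic_Cauchy_const[of p c]] by (simp add: mult.commute)

lemma padic_Cauchy_const_mult:
  assumes "prime p" "padic_Cauchy p s"
  shows "padic_Cauchy p (\<lambda>n. c * s n)"
  using padic_Cauchy_mult[OF assms(1) padic_Cauchy_const[of p c] assms(2)] .

lemma padic_null_const_iff: "prime p \<Longrightarrow> padic_null p (\<lambda>_. x) \<longleftrightarrow> x = 0"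
  by (simp add: padic_null_def LIMSEQ_const_iff padic_abs_eq_0_iff)

lemma isotropic_commute: "isotropic p a b \<longleftrightarrow> isotropic p b a"
proof -
  have "isotropic p b a" if "isotropic p a b" for a b
  proof -
    from that obtain x y z where "padic_Cauchy p x" "padic_Cauchy p y" "padic_Cauchy p z"
      "\<not> (padic_null p x \<and> padic_null p y \<and> padic_null p z)"
      "padic_null p (\<lambda>n. z n ^ 2 - a * x n ^ 2 - b * y n ^ 2)"
      unfolding isotropic_def by blast
    then show ?thesis
      by (intro isotropicI[of p y x z]) (auto simp: algebra_simps)
  qed
  then show ?thesis by blast
qed

text \<open>The factor is absorbed by substituting c x for x; the converse is the same substitution
  with the inverse of c.\<close>

lemma isotropic_mult_square_left:
  assumes "prime p" "c \<noteq> 0"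
  shows "isotropic p (a * c\<^sup>2) b \<longleftrightarrow> isotropic p a b"
proof -
  have imp: "isotropic p a b" if iso: "isotropic p (a * c\<^sup>2) b" and c: "c \<noteq> 0" for a c
  proof -
    from iso obtain x y z where xyz: "padic_Cauchy p x" "padic_Cauchy p y" "padic_Cauchy p z"
      "\<not> (padic_null p x \<and> padic_null p y \<and> padic_null p z)"
      "padic_null p (\<lambda>n. z n ^ 2 - a * c\<^sup>2 * x n ^ 2 - b * y n ^ 2)"
      unfolding isotropic_def by blast
    have "padic_null p x" if "padic_null p (\<lambda>n. c * x n)"
      using padic_null_const_mult[OF assms(1) that, of "inverse c"] c
      by (simp flip: mult.assoc)
    with xyz show ?thesis
      by (intro isotropicI[of p "\<lambda>n. c * x n" y z] padic_Cauchy_const_mult assms)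
        (auto simp: power_mult_distrib mult.assoc)
  qed
  have "a * c\<^sup>2 * (inverse c)\<^sup>2 = a"
  proof -
    have "a * c\<^sup>2 * (inverse c)\<^sup>2 = a * (c * inverse c)\<^sup>2"
      by (simp only: power_mult_distrib mult.assoc)
    then show ?thesis using assms(2) by simp
  qed
  then show ?thesis
    using imp[of a c] imp[of "a * c\<^sup>2" "inverse c"] assms(2)
      nonzero_imp_inverse_nonzero[OF assms(2)] by metis
qed

lemma isotropic_mult_square_right:
  "prime p \<Longrightarrow> c \<noteq> 0 \<Longrightarrow> isotropic p a (b * c\<^sup>2) \<longleftrightarrow> isotropic p a b"
  using isotropic_mult_square_left isotropic_commute by metis

section \<open>From p-adic zeros to primitive integer zeros modulo powers of p\<close>

lemma padic_abs_of_int: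
  assumes "prime p" "x \<noteq> 0"
  shows "padic_abs p (of_int x) = 1 / real p ^ multiplicity (int p) x"
  using padic_val_of_int_div[OF assms(1,2), of 1] assms
  by (simp add: padic_abs_def power_int_minus inverse_eq_divide)

lemma padic_abs_of_int_le:
  assumes "prime p" "int p ^ k dvd x"
  shows "padic_abs p (of_int x) \<le> 1 / real p ^ k"
proof (cases "x = 0")
  case False
  have "real p > 1" using assms(1) prime_gt_1_nat by auto
  moreover have "k \<le> multiplicity (int p) x"
    using assms False by (intro multiplicity_geI) auto
  ultimately show ?thesis
    unfolding padic_abs_of_int[OF assms(1) False]
    by (intro divide_left_mono power_increasing mult_pos_pos) auto
qed simp

lemma padic_abs_of_int_less_imp_dvd:
  assumes "prime p" "padic_abs p (of_int x) < 1 / real p ^ k"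
  shows "int p ^ k dvd x"
proof (cases "x = 0")
  case False
  have p: "real p > 1" using assms(1) prime_gt_1_nat by auto
  have "1 / real p ^ multiplicity (int p) x < 1 / real p ^ k"
    using assms(2) padic_abs_of_int[OF assms(1) False] by simp
  then have "real p ^ k < real p ^ multiplicity (int p) x"
    using p by (simp add: divide_less_eq less_divide_eq)
  then have "k < multiplicity (int p) x" using p by simp
  then show ?thesis by (intro multiplicity_dvd') simp
qed simp

text \<open>The scaling factor \<open>s\<close> is exposed because its p-adic size has to be
  estimated afterwards.\<close>

lemma rat_triple_primitive:
  fixes x y z :: rat
  assumes "\<not> (x = 0 \<and> y = 0 \<and> z = 0)"
  obtains s X Y Z where "s * x = of_int X" "s * y = of_int Y" "s * z = of_int Z"
    "s \<noteq> 0" "gcd X (gcd Y Z) = 1"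
proof -
  have ex: "\<exists>a b. t = of_int a / of_int b \<and> b > 0" for t :: rat
    by (metis quotient_of_denom_pos quotient_of_div surj_pair)
  obtain a b where x: "x = of_int a / of_int b" and b: "b > 0" using ex by blast
  obtain c d where y: "y = of_int c / of_int d" and d: "d > 0" using ex by blast
  obtain e f where z: "z = of_int e / of_int f" and f: "f > 0" using ex by blast
  define A C E where "A = a * d * f" and "C = c * b * f" and "E = e * b * d"
  define g where "g = gcd A (gcd C E)"
  have "A \<noteq> 0 \<or> C \<noteq> 0 \<or> E \<noteq> 0"
    using assms b d f by (auto simp: x y z A_def C_def E_def)
  then have g: "g \<noteq> 0" by (auto simp: g_def)
  have dvd: "g dvd A" "g dvd C" "g dvd E" by (auto simp: g_def intro: dvd_trans[OF gcd_dvd2])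
  have div: "of_int (t div g) = (of_int t / of_int g :: rat)" if "g dvd t" for t
    using that g by (auto elim!: dvdE)
  show ?thesis
  proof
    let ?s = "of_int (b * d * f) / of_int g :: rat"
    show "?s * x = of_int (A div g)" "?s * y = of_int (C div g)" "?s * z = of_int (E div g)"
      using b d f unfolding div[OF dvd(1)] div[OF dvd(2)] div[OF dvd(3)]
      by (simp_all add: x y z A_def C_def E_def)
    show "?s \<noteq> 0" using b d f g by simp
    have "\<bar>g\<bar> * gcd (A div g) (gcd (C div g) (E div g)) = \<bar>g\<bar>"
      using dvd gcd_mult_distrib_int[of g "A div g" "gcd (C div g) (E div g)"]
        gcd_mult_distrib_int[of g "C div g" "E div g"]
      by (simp add: g_def abs_mult gcd_mult_distrib_int)
    then show "gcd (A div g) (gcd (C div g) (E div g)) = 1" using g by simp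
  qed
qed

text \<open>A far term of the sequences is a rational near-solution; it is scaled to a primitive
  integer triple. Some coordinate stays at least c in absolute value and becomes an integer after
  scaling by s, so the absolute value of s is at most 1/c and the error remains small.\<close>

lemma isotropic_imp_primitive_solution:
  assumes p: "prime p" and iso: "isotropic p (of_int a) (of_int b)"
  obtains X Y Z where "\<not> (int p dvd X \<and> int p dvd Y \<and> int p dvd Z)"
    "int p ^ k dvd Z\<^sup>2 - a * X\<^sup>2 - b * Y\<^sup>2"
proof -
  obtain x y z where xyz: "padic_Cauchy p x" "padic_Cauchy p y" "padic_Cauchy p z"
      and nn: "\<not> (padic_null p x \<and> padic_null p y \<and> padic_null p z)"
      and null: "padic_null p (\<lambda>n. z n ^ 2 - of_int a * x n ^ 2 - of_int b * y n ^ 2)"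
    using iso unfolding isotropic_def by blast
  obtain w where w: "w \<in> {x, y, z}" "padic_Cauchy p w" "\<not> padic_null p w"
    using xyz nn by blast
  obtain c N where c: "c > 0" "\<And>n. n \<ge> N \<Longrightarrow> padic_abs p (w n) \<ge> c"
    using padic_Cauchy_not_null[OF p w(2,3)] by blast
  have pk: "real p ^ k > 0" using p prime_gt_0_nat by auto
  \<comment> \<open>Scaling by s multiplies the error by at most 1/c^2; this choice leaves it below
    p^(-k).\<close>
  define e where "e = c\<^sup>2 * (1 / real p ^ k)"
  have "e > 0" using c pk by (simp add: e_def)
  then obtain M where M: "\<And>n. n \<ge> M \<Longrightarrow>
      padic_abs p (z n ^ 2 - of_int a * x n ^ 2 - of_int b * y n ^ 2) < e"
    using null unfolding padic_null_def LIMSEQ_iff by auto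
  define n where "n = max M N"
  define r where "r = z n ^ 2 - of_int a * x n ^ 2 - of_int b * y n ^ 2"
  have r: "padic_abs p r < e" using M[of n] by (simp add: n_def r_def)
  have wn: "padic_abs p (w n) \<ge> c" using c(2)[of n] by (simp add: n_def)
  then have "w n \<noteq> 0" using c(1) by auto
  then have "\<not> (x n = 0 \<and> y n = 0 \<and> z n = 0)" using w(1) by auto
  then obtain s X Y Z where s: "s * x n = of_int X" "s * y n = of_int Y" "s * z n = of_int Z"
    "s \<noteq> 0" "gcd X (gcd Y Z) = 1" by (rule rat_triple_primitive)
  obtain W where W: "s * w n = of_int W" using w(1) s by auto
  have "padic_abs p (of_int W) \<le> 1" using padic_abs_of_int_le[OF p, of 0 W] by simp
  then have le1: "padic_abs p s * padic_abs p (w n) \<le> 1"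
    by (simp flip: W padic_abs_mult[OF p])
  have "padic_abs p s * c \<le> padic_abs p s * padic_abs p (w n)"
    using wn by (intro mult_left_mono) auto
  with le1 have sc: "padic_abs p s * c \<le> 1" by linarith
  have "of_int (Z\<^sup>2 - a * X\<^sup>2 - b * Y\<^sup>2) = s\<^sup>2 * r"
    by (simp add: s(1-3)[symmetric] r_def power_mult_distrib algebra_simps)
  then have "padic_abs p (of_int (Z\<^sup>2 - a * X\<^sup>2 - b * Y\<^sup>2)) = (padic_abs p s)\<^sup>2 * padic_abs p r"
    by (simp only: padic_abs_mult[OF p] power2_eq_square)
  also have "\<dots> < (padic_abs p s)\<^sup>2 * e"
    using r s(4) padic_abs_eq_0_iff[OF p, of s] by (intro mult_strict_left_mono) auto
  also have "\<dots> = (padic_abs p s * c)\<^sup>2 * (1 / real p ^ k)"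
    by (simp add: e_def power_mult_distrib)
  also have "\<dots> \<le> 1 * (1 / real p ^ k)"
    using sc c(1) pk by (intro mult_right_mono power_le_one) auto
  finally have "int p ^ k dvd Z\<^sup>2 - a * X\<^sup>2 - b * Y\<^sup>2"
    by (intro padic_abs_of_int_less_imp_dvd[OF p]) simp
  moreover have "\<not> (int p dvd X \<and> int p dvd Y \<and> int p dvd Z)"
  proof
    assume "int p dvd X \<and> int p dvd Y \<and> int p dvd Z"
    then have "int p dvd gcd X (gcd Y Z)" by simp
    then show False using s(5) p by simp
  qed
  ultimately show ?thesis using that by blast
qed

text \<open>A Newton step: 2 x is invertible modulo p because p is odd and x^2 is congruent to the
  unit u. The second conclusion makes the iterates a Cauchy sequence.\<close>

lemma hensel_step:
  assumes p: "prime p" "p > 2" and u: "\<not> int p dvd u" and x: "int p ^ Suc n dvd x\<^sup>2 - u"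
  obtains y where "int p ^ Suc (Suc n) dvd y\<^sup>2 - u" "int p ^ Suc n dvd y - x"
proof -
  have "int p dvd x\<^sup>2 - u" using x by (rule dvd_trans[rotated]) simp
  then have "\<not> int p dvd x"
    using u by (metis dvd_diff_right_iff dvd_power zero_less_numeral dvd_trans)
  moreover have "\<not> int p dvd 2" using p zdvd_imp_le[of "int p" 2] by auto
  ultimately have "coprime (2 * x) (int p)"
    using p(1) by (metis coprime_commute prime_dvd_mult_iff prime_imp_coprime prime_int_nat_transfer
        prime_nat_int_transfer)
  then obtain i where i: "[2 * x * i = 1] (mod int p)" using cong_solve_coprime_int by blast
  obtain m where m: "x\<^sup>2 - u = int p ^ Suc n * m" using x by blast
  \<comment> \<open>As i inverts 2 x modulo p, this t solves m + 2 x t = 0 modulo p.\<close>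
  define t where "t = - m * i"
  have "[m + 2 * x * t = m - m * (2 * x * i)] (mod int p)"
    by (simp add: t_def algebra_simps)
  also have "[m - m * (2 * x * i) = m - m * 1] (mod int p)"
    by (intro cong_diff cong_mult cong_refl i)
  finally have "int p dvd m + 2 * x * t" by (simp add: cong_0_iff)
  moreover have "(x + int p ^ Suc n * t)\<^sup>2 - u =
      int p ^ Suc n * ((m + 2 * x * t) + int p * (int p ^ n * t\<^sup>2))"
  proof -
    have "(x + int p ^ Suc n * t)\<^sup>2 - u = (x\<^sup>2 - u) + 2 * x * (int p ^ Suc n * t) + (int p ^ Suc n * t)\<^sup>2"
      by (simp add: power2_eq_square algebra_simps)
    then show ?thesis unfolding m by (simp add: power2_eq_square algebra_simps)
  qed
  ultimately have "int p ^ Suc n * int p dvd (x + int p ^ Suc n * t)\<^sup>2 - u"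
    by (metis dvd_add dvd_triv_left mult_dvd_mono dvd_refl)
  then show ?thesis by (intro that[of "x + int p ^ Suc n * t"]) (auto simp: mult_ac)
qed

lemma padic_sqrt:
  assumes p: "prime p" "p > 2" and u: "\<not> int p dvd u" "QuadRes (int p) u"
  obtains s where "padic_Cauchy p s" "padic_null p (\<lambda>n. s n ^ 2 - of_int u)"
proof -
  obtain x0 where "int p dvd x0\<^sup>2 - u"
    using u(2) by (auto simp: QuadRes_def cong_iff_dvd_diff)
  then have "\<exists>x. int p ^ Suc 0 dvd x\<^sup>2 - u" by auto
  \<comment> \<open>The n-th iterate is a root modulo p^(n+1), so a root modulo p starts the
    sequence.\<close>
  then have "\<exists>f. \<forall>n. int p ^ Suc n dvd (f n)\<^sup>2 - u \<and> int p ^ Suc n dvd f (Suc n) - f n"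
    by (intro dependent_nat_choice) (use hensel_step[OF p u(1)] in blast)+
  then obtain f where f: "\<And>n. int p ^ Suc n dvd (f n)\<^sup>2 - u" "\<And>n. int p ^ Suc n dvd f (Suc n) - f n"
    by blast
  have inv: "(\<lambda>n. 1 / real p ^ Suc n) \<longlonglongrightarrow> 0"
    using LIMSEQ_Suc[OF LIMSEQ_inverse_realpow_zero[of "real p"]] p
    by (simp add: inverse_eq_divide)
  have diff: "int p ^ Suc N dvd f n - f N" if "n \<ge> N" for n N
    using that
  proof (induction n rule: dec_induct)
    case (step n)
    have "int p ^ Suc N dvd f (Suc n) - f n"
      using f(2) by (rule dvd_trans[rotated]) (use step in \<open>simp add: le_imp_power_dvd\<close>)
    from dvd_add[OF this step.IH] show ?case by simp
  qed simp
  have "padic_Cauchy p (\<lambda>n. of_int (f n))"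
    unfolding padic_Cauchy_def
  proof (intro allI impI)
    fix e :: real assume "e > 0"
    then obtain N where "1 / real p ^ Suc N < e"
      using order_tendstoD(2)[OF inv, of e] by (meson eventually_sequentially order_refl)
    moreover have "padic_abs p (of_int (f m) - of_int (f n)) \<le> 1 / real p ^ Suc N"
      if "m \<ge> N" "n \<ge> N" for m n
    proof -
      have "int p ^ Suc N dvd f m - f n"
        using dvd_diff[OF diff[OF that(1)] diff[OF that(2)]] by simp
      from padic_abs_of_int_le[OF p(1) this] show ?thesis by simp
    qed
    ultimately show "\<exists>N. \<forall>m\<ge>N. \<forall>n\<ge>N. padic_abs p (of_int (f m) - of_int (f n)) < e"
      by (meson order.strict_trans1)
  qed
  moreover have "padic_null p (\<lambda>n. of_int (f n) ^ 2 - of_int u)"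
    unfolding padic_null_def
  proof (rule tendsto_sandwich[OF _ _ tendsto_const inv])
    have "padic_abs p (of_int (f n) ^ 2 - of_int u) \<le> 1 / real p ^ Suc n" for n
      using padic_abs_of_int_le[OF p(1) f(1)[of n]] by simp
    then show "\<forall>\<^sub>F n in sequentially. padic_abs p (of_int (f n) ^ 2 - of_int u) \<le> 1 / real p ^ Suc n"
      by simp
  qed simp
  ultimately show ?thesis by (rule that)
qed

section \<open>Isotropy for coefficients of valuation 0 or 1 at an odd prime\<close>

lemma isotropic_unit_square:
  assumes p: "prime p" "p > 2" and u: "\<not> int p dvd a * x\<^sup>2 + b * y\<^sup>2" "QuadRes p (a * x\<^sup>2 + b * y\<^sup>2)"
  shows "isotropic p (of_int a) (of_int b)"
proof -
  obtain s where s: "padic_Cauchy p s" "padic_null p (\<lambda>n. s n ^ 2 - of_int (a * x\<^sup>2 + b * y\<^sup>2))"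
    using padic_sqrt[OF p u] by blast
  have "x \<noteq> 0 \<or> y \<noteq> 0" using u(1) by auto
  then show ?thesis
    using s p(1) by (intro isotropicI[of p "\<lambda>_. of_int x" "\<lambda>_. of_int y" s] padic_Cauchy_const)
      (auto simp: padic_null_const_iff algebra_simps)
qed

text \<open>With s a square root of -a b, the triple x = s, y = a, z = 0 is a zero: p a s^2 + p b
  a^2 = 0.\<close>

lemma isotropic_both_ramified:
  assumes p: "prime p" "p > 2" and u: "\<not> int p dvd a" "\<not> int p dvd b" "QuadRes p (- (a * b))"
  shows "isotropic p (of_int (int p * a)) (of_int (int p * b))"
proof -
  have "\<not> int p dvd - (a * b)" using u p by (simp add: prime_dvd_mult_iff)
  then obtain s where s: "padic_Cauchy p s" "padic_null p (\<lambda>n. s n ^ 2 - of_int (- (a * b)))"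
    using padic_sqrt[OF p _ u(3)] by blast
  have "a \<noteq> 0" using u(1) by auto
  have "padic_null p (\<lambda>n. - of_int (int p * a) * (s n ^ 2 - of_int (- (a * b))))"
    by (intro padic_null_const_mult p s)
  also have "(\<lambda>n. - of_int (int p * a) * (s n ^ 2 - of_int (- (a * b)))) =
      (\<lambda>n. 0 ^ 2 - of_int (int p * a) * s n ^ 2 - of_int (int p * b) * of_int a ^ 2)"
    by (simp add: fun_eq_iff power2_eq_square algebra_simps)
  finally show ?thesis
    using s p(1) \<open>a \<noteq> 0\<close>
    by (intro isotropicI[of p s "\<lambda>_. of_int a" "\<lambda>_. 0"] padic_Cauchy_const)
      (auto simp: padic_null_const_iff)
qed

text \<open>x^2 - y^2 factors, and on this range neither factor can be a nonzero multiple of p. The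
  constant c lets one count serve both sides of a x^2 = 1 - b y^2.\<close>

lemma inj_on_unit_squares:
  assumes p: "prime p" and a: "\<not> int p dvd a"
  shows "inj_on (\<lambda>x. (c + a * x\<^sup>2) mod int p) {0..(int p - 1) div 2}"
proof (rule inj_onI)
  fix x y assume xy: "x \<in> {0..(int p - 1) div 2}" "y \<in> {0..(int p - 1) div 2}"
    and eq: "(c + a * x\<^sup>2) mod int p = (c + a * y\<^sup>2) mod int p"
  have "int p dvd (c + a * x\<^sup>2) - (c + a * y\<^sup>2)" using eq by (rule mod_eq_dvd_iff[THEN iffD1])
  also have "(c + a * x\<^sup>2) - (c + a * y\<^sup>2) = a * ((x - y) * (x + y))"
    by (simp add: power2_eq_square algebra_simps)
  finally have "int p dvd x - y \<or> int p dvd x + y"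
    using p a by (simp add: prime_dvd_mult_iff)
  then show "x = y"
  proof
    assume "int p dvd x - y"
    then have "int p dvd \<bar>x - y\<bar>" by simp
    moreover have "\<bar>x - y\<bar> < int p" using xy by auto
    ultimately show ?thesis using zdvd_imp_le[of "int p" "\<bar>x - y\<bar>"] by force
  next
    assume "int p dvd x + y"
    moreover have "x + y < int p" using xy by auto
    ultimately show ?thesis using zdvd_imp_le[of "int p" "x + y"] xy by force
  qed
qed

lemma isotropic_units:
  assumes p: "prime p" "p > 2" and u: "\<not> int p dvd a" "\<not> int p dvd b"
  shows "isotropic p (of_int a) (of_int b)"
proof -
  let ?H = "{0..(int p - 1) div 2}"
  let ?A = "(\<lambda>x. (0 + a * x\<^sup>2) mod int p) ` ?H" and ?B = "(\<lambda>y. (1 + (- b) * y\<^sup>2) mod int p) ` ?H"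
  have "odd p" using p prime_odd_nat by blast
  have cards: "card ?A = card ?H" "card ?B = card ?H"
    by (rule card_image inj_on_unit_squares p | simp add: u)+
  \<comment> \<open>pigeonhole: each of the two sets contains more than half of the residues\<close>
  have "?A \<inter> ?B \<noteq> {}"
  proof
    assume "?A \<inter> ?B = {}"
    then have "card ?A + card ?B = card (?A \<union> ?B)" by (simp add: card_Un_disjoint)
    also have "\<dots> \<le> card {0..<int p}"
      using p by (intro card_mono) auto
    finally show False unfolding cards using \<open>odd p\<close> by (auto elim!: oddE)
  qed
  then obtain x y where "(0 + a * x\<^sup>2) mod int p = (1 + (- b) * y\<^sup>2) mod int p" by blast
  then have "int p dvd (0 + a * x\<^sup>2) - (1 + (- b) * y\<^sup>2)" by (rule mod_eq_dvd_iff[THEN iffD1])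
  then have dvd: "int p dvd (a * x\<^sup>2 + b * y\<^sup>2) - 1" by (simp add: algebra_simps)
  \<comment> \<open>The value a x^2 + b y^2 is 1 modulo p, hence a nonzero square there, and z can
    be taken as its p-adic root.\<close>
  show ?thesis
  proof (rule isotropic_unit_square[OF p])
    show "\<not> int p dvd a * x\<^sup>2 + b * y\<^sup>2"
    proof
      assume "int p dvd a * x\<^sup>2 + b * y\<^sup>2"
      from dvd_diff[OF this dvd] show False using p(1) by simp
    qed
    show "QuadRes p (a * x\<^sup>2 + b * y\<^sup>2)"
      using dvd unfolding QuadRes_def
      by (intro exI[of _ 1]) (simp add: cong_iff_dvd_diff dvd_diff_commute)
  qed
qed

lemma QuadRes_of_square_cong:
  assumes "prime p" "\<not> int p dvd x" "[z\<^sup>2 = a * x\<^sup>2] (mod int p)"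
  shows "QuadRes p a"
proof -
  have "coprime x (int p)"
    using assms(1,2) by (metis coprime_commute prime_imp_coprime prime_nat_int_transfer)
  then obtain i where i: "[x * i = 1] (mod int p)" using cong_solve_coprime_int by blast
  have "[(z * i)\<^sup>2 = a * (x * i)\<^sup>2] (mod int p)"
    using cong_mult[OF assms(3) cong_refl[of "i\<^sup>2"]] by (simp add: power_mult_distrib mult_ac)
  also have "[a * (x * i)\<^sup>2 = a * 1\<^sup>2] (mod int p)"
    by (intro cong_mult cong_refl cong_pow i)
  finally show ?thesis unfolding QuadRes_def by auto
qed

lemma isotropic_unit_ramified:
  assumes p: "prime p" "p > 2" and u: "\<not> int p dvd a" "\<not> int p dvd b"
  shows "isotropic p (of_int a) (of_int (int p * b)) \<longleftrightarrow> QuadRes p a"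
proof
  assume "QuadRes p a"
  then show "isotropic p (of_int a) (of_int (int p * b))"
    using isotropic_unit_square[OF p, of a 1 "int p * b" 0] u by simp
next
  assume "isotropic p (of_int a) (of_int (int p * b))"
  \<comment> \<open>Precision p^2 is what rules out p | X: then p | Z, the first two terms vanish
    modulo p^2, and p | Y would follow, against primitivity.\<close>
  then obtain X Y Z where XYZ: "\<not> (int p dvd X \<and> int p dvd Y \<and> int p dvd Z)"
    "int p ^ 2 dvd Z\<^sup>2 - a * X\<^sup>2 - int p * b * Y\<^sup>2"
    using isotropic_imp_primitive_solution[OF p(1)] by blast
  have prime: "prime (int p)" using p by simp
  have "int p dvd Z\<^sup>2 - a * X\<^sup>2 - int p * b * Y\<^sup>2"
    using XYZ(2) by (rule dvd_trans[rotated]) simp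
  then have "int p dvd Z\<^sup>2 - a * X\<^sup>2 - int p * b * Y\<^sup>2 + int p * (b * Y\<^sup>2)"
    by (rule dvd_add) simp
  then have dvd: "int p dvd Z\<^sup>2 - a * X\<^sup>2" by (simp add: algebra_simps)
  have "\<not> int p dvd X"
  proof
    assume X: "int p dvd X"
    then have "int p dvd a * X\<^sup>2" by (simp add: power2_eq_square)
    from dvd_add[OF dvd this] have "int p dvd Z\<^sup>2" by simp
    then have Z: "int p dvd Z" using prime by (simp add: prime_dvd_power_iff)
    have "int p ^ 2 dvd Z\<^sup>2 - a * X\<^sup>2"
      using X Z by (intro dvd_diff dvd_mult dvd_power_same) auto
    from dvd_diff[OF this XYZ(2)] have "int p * int p dvd int p * (b * Y\<^sup>2)"
      by (simp add: power2_eq_square mult.assoc)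
    then have "int p dvd b * Y\<^sup>2" using prime by (simp del: of_nat_mult)
    then have "int p dvd Y" using u(2) prime by (simp add: prime_dvd_mult_iff prime_dvd_power_iff)
    then show False using X Z XYZ(1) by blast
  qed
  then show "QuadRes p a"
    using dvd by (intro QuadRes_of_square_cong[OF p(1)]) (auto simp: cong_iff_dvd_diff)
qed

lemma isotropic_both_ramified_iff:
  assumes p: "prime p" "p > 2" and u: "\<not> int p dvd a" "\<not> int p dvd b"
  shows "isotropic p (of_int (int p * a)) (of_int (int p * b)) \<longleftrightarrow> QuadRes p (- (a * b))"
proof
  assume "isotropic p (of_int (int p * a)) (of_int (int p * b))"
  then obtain X Y Z where XYZ: "\<not> (int p dvd X \<and> int p dvd Y \<and> int p dvd Z)"
    "int p ^ 2 dvd Z\<^sup>2 - int p * a * X\<^sup>2 - int p * b * Y\<^sup>2"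
    using isotropic_imp_primitive_solution[OF p(1)] by blast
  have prime: "prime (int p)" using p by simp
  have "int p dvd Z\<^sup>2 - int p * a * X\<^sup>2 - int p * b * Y\<^sup>2"
    using XYZ(2) by (rule dvd_trans[rotated]) simp
  then have "int p dvd Z\<^sup>2 - int p * a * X\<^sup>2 - int p * b * Y\<^sup>2 + int p * (a * X\<^sup>2 + b * Y\<^sup>2)"
    by (rule dvd_add) simp
  then have "int p dvd Z\<^sup>2" by (simp add: algebra_simps)
  then have Z: "int p dvd Z" using prime by (simp add: prime_dvd_power_iff)
  then have "int p ^ 2 dvd Z\<^sup>2" by (rule dvd_power_same)
  from dvd_diff[OF this XYZ(2)] have "int p * int p dvd int p * (a * X\<^sup>2 + b * Y\<^sup>2)"
    by (simp add: power2_eq_square algebra_simps)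
  then have dvd: "int p dvd a * X\<^sup>2 + b * Y\<^sup>2" using prime by (simp del: of_nat_mult)
  have "\<not> int p dvd Y"
  proof
    assume Y: "int p dvd Y"
    then have "int p dvd b * Y\<^sup>2" by (simp add: power2_eq_square)
    then have "int p dvd a * X\<^sup>2" using dvd by (simp add: dvd_add_left_iff)
    then have "int p dvd X" using u(1) prime by (simp add: prime_dvd_mult_iff prime_dvd_power_iff)
    then show False using Y Z XYZ(1) by blast
  qed
  \<comment> \<open>Multiplying by a turns the first term into the square (a X)^2.\<close>
  moreover have "int p dvd a * (a * X\<^sup>2 + b * Y\<^sup>2)" using dvd by simp
  then have "[(a * X)\<^sup>2 = - (a * b) * Y\<^sup>2] (mod int p)"
    by (simp add: cong_iff_dvd_diff power2_eq_square algebra_simps)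
  ultimately show "QuadRes p (- (a * b))" by (rule QuadRes_of_square_cong[OF p(1)])
qed (rule isotropic_both_ramified[OF assms])

lemma isotropic_iff_tame_symbol_reduced:
  assumes p: "prime p" "p > 2" and u: "\<not> int p dvd a" "\<not> int p dvd b"
    and "e \<in> {0, 1}" "f \<in> {0, 1}"
  shows "isotropic p (of_int (int p ^ e * a)) (of_int (int p ^ f * b)) \<longleftrightarrow>
    tame_symbol p (int p ^ e * a) (int p ^ f * b) = 1"
proof -
  have prime: "prime (int p)" using p by simp
  have ab: "\<not> int p dvd - (a * b)" using prime u by (simp add: prime_dvd_mult_iff)
  note decomposed = multiplicity_decomposed[OF prime] unit_part_decomposed[OF prime]
  have L: "Legendre (- (a * b)) p = Legendre (- 1) p * Legendre a p * Legendre b p"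
    using Legendre_mult[OF p, of "- 1" "a * b"] Legendre_mult[OF p, of a b] by simp
  consider "e = 0" "f = 0" | "e = 0" "f = 1" | "e = 1" "f = 0" | "e = 1" "f = 1"
    using assms(5,6) by auto
  then show ?thesis
  proof cases
    case 1
    then show ?thesis using isotropic_units[OF p u] tame_symbol_eq_1[of p a b] u by simp
  next
    case 2
    have "tame_symbol p (int p ^ e * a) (int p ^ f * b) = Legendre a p"
      unfolding tame_symbol_def decomposed(1)[OF u(1)] decomposed(2)[OF u(1)]
        decomposed(1)[OF u(2)] decomposed(2)[OF u(2)] using 2 by simp
    then show ?thesis
      using 2 isotropic_unit_ramified[OF p u] Legendre_eq_1_iff[OF u(1)] by simp
  next
    case 3
    have "tame_symbol p (int p ^ e * a) (int p ^ f * b) = Legendre b p"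
      unfolding tame_symbol_def decomposed(1)[OF u(1)] decomposed(2)[OF u(1)]
        decomposed(1)[OF u(2)] decomposed(2)[OF u(2)] using 3 by simp
    moreover have "isotropic p (of_int (int p * a)) (of_int b) \<longleftrightarrow> QuadRes p b"
      using isotropic_unit_ramified[OF p u(2,1)] isotropic_commute by blast
    ultimately show ?thesis
      using 3 Legendre_eq_1_iff[OF u(2)] by simp
  next
    case 4
    have "tame_symbol p (int p ^ e * a) (int p ^ f * b) = Legendre (- (a * b)) p"
      unfolding tame_symbol_def decomposed(1)[OF u(1)] decomposed(2)[OF u(1)]
        decomposed(1)[OF u(2)] decomposed(2)[OF u(2)] L using 4 by simp
    then show ?thesis
      using 4 isotropic_both_ramified_iff[OF p u] Legendre_eq_1_iff[OF ab] by simp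
  qed
qed

lemma isotropic_iff_tame_symbol:
  assumes p: "prime p" "p > 2" and "a \<noteq> 0" "b \<noteq> 0"
  shows "isotropic p (of_int a) (of_int b) \<longleftrightarrow> tame_symbol p a b = 1"
proof -
  interpret symbol "tame_symbol p" by (rule symbol_tame_symbol[OF p])
  have prime: "prime (int p)" using p by simp
  \<comment> \<open>Both sides of the claim depend on a and b only up to squares, so only the parity
    of each valuation has to be kept.\<close>
  have split: "\<exists>e c y. e \<in> {0, 1} \<and> x = (int p ^ e * y) * c\<^sup>2 \<and> \<not> int p dvd y \<and> c \<noteq> 0"
    if "x \<noteq> 0" for x
  proof (intro exI conjI)
    let ?k = "multiplicity (int p) x"
    show "?k mod 2 \<in> {0, 1}" by auto
    have "x = int p ^ (?k mod 2 + ?k div 2 * 2) * unit_part p x"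
      using unit_part_eq[of x p] by simp
    then show "x = (int p ^ (?k mod 2) * unit_part p x) * (int p ^ (?k div 2))\<^sup>2"
      by (simp only: power_add power_mult mult.assoc mult.commute[of _ "unit_part p x"])
    show "\<not> int p dvd unit_part p x" by (rule not_dvd_unit_part[OF prime that])
    show "int p ^ (?k div 2) \<noteq> 0" using p by simp
  qed
  obtain e c a' where a: "a = (int p ^ e * a') * c\<^sup>2" (is "_ = ?a * _")
      "\<not> int p dvd a'" "c \<noteq> 0" "e \<in> {0, 1}"
    using split[OF assms(3)] by metis
  obtain f d b' where b: "b = (int p ^ f * b') * d\<^sup>2" (is "_ = ?b * _")
      "\<not> int p dvd b'" "d \<noteq> 0" "f \<in> {0, 1}"
    using split[OF assms(4)] by metis
  have nz: "?a \<noteq> 0" "?b \<noteq> 0" using a b assms(3,4) by auto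
  have "isotropic p (of_int (?a * c\<^sup>2)) (of_int (?b * d\<^sup>2)) \<longleftrightarrow> isotropic p (of_int ?a) (of_int ?b)"
    using a(3) b(3) p(1) by (simp only: of_int_mult of_int_power of_int_eq_0_iff not_False_eq_True
        isotropic_mult_square_left isotropic_mult_square_right)
  also have "\<dots> \<longleftrightarrow> tame_symbol p ?a ?b = 1"
    by (rule isotropic_iff_tame_symbol_reduced[OF p a(2) b(2) a(4) b(4)])
  also have "tame_symbol p ?a ?b = tame_symbol p (?a * c\<^sup>2) (?b * d\<^sup>2)"
  proof -
    have "?b * d\<^sup>2 \<noteq> 0" using nz b(3) by simp
    then show ?thesis
      using mult_square_left[OF nz(1) _ a(3)] mult_square_right[OF nz b(3)] by simp
  qed
  finally show ?thesis unfolding a(1) b(1) .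
qed

lemma hilbert_symbol_eq_tame_symbol:
  fixes u v w :: int
  assumes p: "prime p" "p > 2" and nz: "u \<noteq> 0" "v \<noteq> 0" "w \<noteq> 0"
  shows "hilbert_symbol p (padic_of_rat p (- (of_int u / of_int w)))
           (padic_of_rat p (- (of_int v / of_int w))) = tame_symbol p (- (u * w)) (- (v * w))"
proof -
  interpret symbol "tame_symbol p" by (rule symbol_tame_symbol[OF p])
  let ?w = "1 / of_int w :: rat"
  have eq: "- (of_int x / of_int w) = of_int (- (x * w)) * ?w\<^sup>2" for x
    using nz(3) by (simp add: power2_eq_square)
  have "?w \<noteq> 0" using nz(3) by simp
  then have "isotropic p (- (of_int u / of_int w)) (- (of_int v / of_int w)) \<longleftrightarrow>
      isotropic p (of_int (- (u * w))) (of_int (- (v * w)))"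
    unfolding eq by (simp only: not_False_eq_True isotropic_mult_square_left[OF p(1)] isotropic_mult_square_right[OF p(1)])
  also have "\<dots> \<longleftrightarrow> tame_symbol p (- (u * w)) (- (v * w)) = 1"
    using nz by (intro isotropic_iff_tame_symbol p) auto
  \<comment> \<open>The tame symbol is a sign, so knowing when it equals 1 determines it.\<close>
  finally show ?thesis
    using square_1[of "- (u * w)" "- (v * w)"] nz
    by (auto simp: hilbert_symbol_eq_isotropic[OF p(1)] zmult_eq_1_iff)
qed


section \<open>The equation at the primes not dividing n\<close>

text \<open>Denominators are cleared and signs left free, which suits the valuation arguments;
  positivity enters the proof only at the real place.\<close>

definition egyptian :: "int \<Rightarrow> int \<Rightarrow> int \<Rightarrow> int \<Rightarrow> bool" where
  "egyptian n u v w \<longleftrightarrow> u \<noteq> 0 \<and> v \<noteq> 0 \<and> w \<noteq> 0 \<and> 4 * (u * v * w) = n * (u * v + u * w + v * w)"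

lemma egyptian_commute:
  "egyptian n u v w \<longleftrightarrow> egyptian n v u w" "egyptian n u v w \<longleftrightarrow> egyptian n w v u"
  by (auto simp: egyptian_def algebra_simps)

text \<open>The equation reads u v (4 w - n) = n w (u + v). If w alone had the largest valuation,
  then p would divide w and 4 w - n would be a unit, so the right side would have a larger valuation
  than the left.\<close>

lemma egyptian_max_multiplicity:
  assumes p: "prime p" "\<not> p dvd n" and eg: "egyptian n u v w"
  shows "multiplicity p w \<le> multiplicity p u \<or> multiplicity p w \<le> multiplicity p v"
proof (rule ccontr)
  let ?a = "multiplicity p u" and ?b = "multiplicity p v" and ?c = "multiplicity p w"
  assume "\<not> ?thesis"
  then have less: "?a < ?c" "?b < ?c" by auto
  have nz: "u \<noteq> 0" "v \<noteq> 0" "w \<noteq> 0" and eq: "4 * (u * v * w) = n * (u * v + u * w + v * w)"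
    using eg by (auto simp: egyptian_def)
  have "p dvd w" using less(1) not_dvd_imp_multiplicity_0 by fastforce
  then have nd: "\<not> p dvd 4 * w - n" using p(2) by (simp add: dvd_diff_right_iff)
  then have "4 * w - n \<noteq> 0" by auto
  then have mult: "multiplicity p (u * v * (4 * w - n)) = ?a + ?b"
    using p(1) nz nd by (simp add: multiplicity_mult not_dvd_imp_multiplicity_0)
  have "p ^ min ?a ?b dvd u + v" by (intro dvd_add multiplicity_dvd') auto
  then have "p ^ ?c * p ^ min ?a ?b dvd w * (u + v)" by (intro mult_dvd_mono multiplicity_dvd)
  moreover have "u * v * (4 * w - n) = n * (w * (u + v))" using eq by (simp add: algebra_simps)
  ultimately have "p ^ (?c + min ?a ?b) dvd u * v * (4 * w - n)" by (simp add: power_add)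
  then have "?c + min ?a ?b \<le> ?a + ?b"
    unfolding mult[symmetric] using p(1) nz \<open>4 * w - n \<noteq> 0\<close>
    by (intro multiplicity_geI) auto
  then show False using less by auto
qed

text \<open>Reduction by symmetry to two valuation patterns, for the tame and dyadic symbols alike.
  \<open>distinct\<close> and \<open>equal\<close> range over all triples because
  \<open>distinct\<close> is applied to permuted ones.\<close>

lemma (in symbol) egyptian_ternary_eq_1:
  assumes p: "prime p" "\<not> p dvd n" and "egyptian n u v w"
    and distinct: "\<And>u v w. egyptian n u v w \<Longrightarrow> multiplicity p u < multiplicity p v \<Longrightarrow>
      multiplicity p v = multiplicity p w \<Longrightarrow> f (- (u * w)) (- (v * w)) = 1"
    and equal: "\<And>u v w. egyptian n u v w \<Longrightarrow> multiplicity p u = multiplicity p v \<Longrightarrow>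
      multiplicity p v = multiplicity p w \<Longrightarrow> f (- (u * w)) (- (v * w)) = 1"
  shows "f (- (u * w)) (- (v * w)) = 1"
proof -
  note eg = \<open>egyptian n u v w\<close>
  have nz: "u \<noteq> 0" "v \<noteq> 0" "w \<noteq> 0" using eg by (auto simp: egyptian_def)
  have eg_v: "egyptian n v u w" and eg_w: "egyptian n w v u" using eg egyptian_commute by blast+
  have "egyptian n u w v" using eg_v egyptian_commute by blast
  note max = egyptian_max_multiplicity[OF p this] egyptian_max_multiplicity[OF p eg]
    egyptian_max_multiplicity[OF p eg_w]
  then consider "multiplicity p u = multiplicity p v" "multiplicity p v = multiplicity p w"
    | "multiplicity p u < multiplicity p v" "multiplicity p v = multiplicity p w"
    | "multiplicity p v < multiplicity p u" "multiplicity p u = multiplicity p w"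
    | "multiplicity p w < multiplicity p v" "multiplicity p v = multiplicity p u"
    by linarith
  then show ?thesis
  proof cases
    case 1 then show ?thesis by (rule equal[OF eg])
  next
    case 2 then show ?thesis by (rule distinct[OF eg])
  next
    case 3 then show ?thesis using distinct[OF eg_v] commute by metis
  next
    \<comment> \<open>Exchanging u and w changes the shape of the pair, unlike the exchange of u and
      v, which is plain commutativity.\<close>
    case 4 then show ?thesis using distinct[OF eg_w] ternary_swap[OF nz] by metis
  qed
qed

text \<open>The common factor p^(2 i + d) of the three pairwise products is cancelled. The case d =
  0 covers three equal valuations.\<close>

lemma egyptian_reduced:
  assumes p: "prime p" and eg: "egyptian n (p ^ i * u) (p ^ (i + d) * v) (p ^ (i + d) * w)"
  shows "n * (u * (v + w) + p ^ d * (v * w)) = 4 * p ^ (i + d) * (u * v * w)" (is ?eq)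
    and "p ^ d dvd n * (u * (v + w))"
proof -
  have "p ^ (i + i + d) * (n * (u * (v + w) + p ^ d * (v * w))) =
      p ^ (i + i + d) * (4 * p ^ (i + d) * (u * v * w))"
    using eg by (simp add: egyptian_def power_add algebra_simps)
  moreover have "p ^ (i + i + d) \<noteq> 0" using p by auto
  ultimately show ?eq by (simp only: mult_cancel_left) simp
  then have "n * (u * (v + w)) = p ^ d * (4 * p ^ i * (u * v * w) - n * (v * w))"
    by (simp add: power_add algebra_simps)
  then show "p ^ d dvd n * (u * (v + w))" by (rule dvdI)
qed

lemma tame_symbol_even:
  assumes p: "prime p" "p > 2" and "a \<noteq> 0" "even (multiplicity (int p) b)"
  shows "tame_symbol p a b = Legendre (unit_part p b) p ^ multiplicity (int p) a"
proof -
  have "\<not> int p dvd - 1" using p by simp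
  then have 1: "(Legendre (- 1) p)\<^sup>2 = 1"
    using Legendre_square_eq_1 by (simp add: power2_eq_square)
  have 2: "(Legendre (unit_part p a) p)\<^sup>2 = 1"
    using Legendre_square_eq_1 not_dvd_unit_part assms by (simp add: power2_eq_square)
  obtain k where "multiplicity (int p) b = 2 * k" using assms(4) by blast
  then show ?thesis
    by (simp add: tame_symbol_def power_mult 2 power_mult[of _ 2] 1 mult.left_commute[of _ 2 k])
qed

text \<open>If v and w share the larger valuation, - (v * w) has even valuation and its unit part is
  a square modulo p. If all three valuations agree, both arguments have even valuation.\<close>

lemma egyptian_tame_symbol:
  assumes p: "prime p" "p > 2" and n: "\<not> int p dvd n" and eg: "egyptian n u v w"
  shows "tame_symbol p (- (u * w)) (- (v * w)) = 1"
proof -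
  interpret symbol "tame_symbol p" by (rule symbol_tame_symbol[OF p])
  have prime: "prime (int p)" using p by simp
  show ?thesis
  proof (rule egyptian_ternary_eq_1[OF prime n eg])
    fix u v w assume eg: "egyptian n u v w"
      and m: "multiplicity (int p) u < multiplicity (int p) v"
        "multiplicity (int p) v = multiplicity (int p) w"
    let ?u = "unit_part p u" and ?v = "unit_part p v" and ?w = "unit_part p w"
    define i where "i = multiplicity (int p) u"
    obtain d where d: "multiplicity (int p) v = i + d" "d > 0"
      using less_imp_add_positive[OF m(1)] unfolding i_def by metis
    have nz: "u \<noteq> 0" "v \<noteq> 0" "w \<noteq> 0" using eg by (auto simp: egyptian_def)
    note nd = not_dvd_unit_part[OF prime nz(1)] not_dvd_unit_part[OF prime nz(2)]
      not_dvd_unit_part[OF prime nz(3)]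
    have "egyptian n (int p ^ i * ?u) (int p ^ (i + d) * ?v) (int p ^ (i + d) * ?w)"
      using eg unit_part_eq[of u p] unit_part_eq[of v p] unit_part_eq[of w p] m(2) d(1)
      by (simp add: i_def)
    from egyptian_reduced(2)[OF prime this]
    have "int p dvd n * (?u * (?v + ?w))" using d(2) by (metis dvd_power dvd_trans)
    then have vw: "int p dvd ?v + ?w" using prime n nd by (simp add: prime_dvd_mult_iff)
    have "Legendre (- (?v * ?w)) p = 1"
    proof (subst Legendre_eq_1_iff)
      show "\<not> int p dvd - (?v * ?w)" using nd prime by (simp add: prime_dvd_mult_iff)
      \<comment> \<open>As p divides the sum of the unit parts of v and w, minus their product is
        the square of the unit part of v modulo p.\<close>
      have "?v\<^sup>2 - - (?v * ?w) = ?v * (?v + ?w)" by (simp add: power2_eq_square algebra_simps)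
      then show "QuadRes p (- (?v * ?w))"
        unfolding QuadRes_def using vw by (intro exI[of _ ?v]) (simp only: cong_iff_dvd_diff dvd_mult)
    qed
    then show "tame_symbol p (- (u * w)) (- (v * w)) = 1"
      using m(2) nz prime by (subst tame_symbol_even[OF p]) (simp_all add: multiplicity_mult unit_part_mult)
  next
    fix u v w assume eg: "egyptian n u v w"
      and m: "multiplicity (int p) u = multiplicity (int p) v"
        "multiplicity (int p) v = multiplicity (int p) w"
    have nz: "u \<noteq> 0" "v \<noteq> 0" "w \<noteq> 0" using eg by (auto simp: egyptian_def)
    have "\<not> int p dvd unit_part p (- (v * w))" using nz by (intro not_dvd_unit_part[OF prime]) auto
    then have "(Legendre (unit_part p (- (v * w))) p)\<^sup>2 = 1"
      using Legendre_square_eq_1 by (simp only: power2_eq_square)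
    then show "tame_symbol p (- (u * w)) (- (v * w)) = 1"
      using m nz prime
      by (subst tame_symbol_even[OF p])
        (simp_all add: multiplicity_mult power_mult flip: mult_2)
  qed
qed

section \<open>Residues modulo 8 and the symbol at 2\<close>

lemma mod_diff_dvd: "m dvd y \<Longrightarrow> (x - y) mod m = x mod (m :: int)"
  using mod_diff_right_eq[of x y m] by simp

lemma mod_4_cong:
  assumes "x mod 8 = y mod (8 :: int)"
  shows "x mod 4 = y mod 4"
proof -
  have "x mod 4 = x mod 8 mod 4" "y mod 4 = y mod 8 mod 4" by (simp_all add: mod_mod_cancel)
  then show ?thesis by (simp only: assms)
qed

lemma eps4_cong: "x mod 8 = x' mod 8 \<Longrightarrow> y mod 8 = y' mod 8 \<Longrightarrow> eps4 x y = eps4 x' y'"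
  by (simp only: eps4_def mod_4_cong[of x x'] mod_4_cong[of y y'])

lemma chi8_cong: "x mod 8 = x' mod 8 \<Longrightarrow> chi8 x = chi8 x'"
  by (simp add: chi8_def)

lemma odd_square_mod_8:
  assumes "odd (x::int)"
  shows "x\<^sup>2 mod 8 = 1"
proof -
  have "x\<^sup>2 mod 8 = (x mod 8)\<^sup>2 mod 8" by (simp add: power_mod)
  with assms show ?thesis by (elim odd_mod_8_cases) simp_all
qed

text \<open>The case where the two larger 2-adic valuations exceed the third by exactly 1. Knowing
  that v + w is even is too weak there, so the whole reduced equation modulo 8 is used, as a finite
  check over odd residues.\<close>

lemma eps4_chi8_identity:
  assumes "odd u" "odd v" "odd w" "8 dvd u * (v + w) + 2 * (v * w)"
  shows "eps4 (- (u * w)) (- (v * w)) * chi8 (- (v * w)) = 1"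
proof -
  have mods: "(- (u * w)) mod 8 = (- ((u mod 8) * (w mod 8))) mod 8"
    "(- (v * w)) mod 8 = (- ((v mod 8) * (w mod 8))) mod 8"
    "(u * (v + w) + 2 * (v * w)) mod 8 =
      ((u mod 8) * ((v mod 8) + (w mod 8)) + 2 * ((v mod 8) * (w mod 8))) mod 8"
    unfolding cong_def[symmetric]
    by (intro cong_minus_minus_iff[THEN iffD2] cong_add cong_mult cong_refl; simp add: cong_def)+
  have "((u mod 8) * ((v mod 8) + (w mod 8)) + 2 * ((v mod 8) * (w mod 8))) mod 8 = 0"
    using assms(4) by (simp only: mods(3)[symmetric] dvd_eq_mod_eq_0)
  then show ?thesis
    unfolding eps4_cong[OF mods(1,2)] chi8_cong[OF mods(2)]
    using assms(1-3) by (elim odd_mod_8_cases) (simp_all add: eps4_def chi8_def)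
qed

lemma egyptian_dyadic_symbol:
  assumes n: "odd n" and eg: "egyptian n u v w"
  shows "dyadic_symbol (- (u * w)) (- (v * w)) = 1"
proof -
  interpret symbol dyadic_symbol by (rule symbol_dyadic_symbol)
  have prime: "prime (2::int)" by simp
  have chi: "chi8 x ^ (2 * k) = 1" for x k by (simp add: chi8_def)
  show ?thesis
  proof (rule egyptian_ternary_eq_1[OF prime n eg])
    fix u v w assume eg: "egyptian n u v w"
      and m: "multiplicity 2 u < multiplicity 2 v" "multiplicity 2 v = multiplicity 2 w"
    let ?u = "unit_part 2 u" and ?v = "unit_part 2 v" and ?w = "unit_part 2 w"
    define i where "i = multiplicity 2 u"
    obtain d where d: "multiplicity 2 v = i + d" "d > 0"
      using less_imp_add_positive[OF m(1)] unfolding i_def by metis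
    have nz: "u \<noteq> 0" "v \<noteq> 0" "w \<noteq> 0" using eg by (auto simp: egyptian_def)
    note odd = not_dvd_unit_part[OF prime nz(1)] not_dvd_unit_part[OF prime nz(2)]
      not_dvd_unit_part[OF prime nz(3)]
    have "egyptian n (2 ^ i * ?u) (2 ^ (i + d) * ?v) (2 ^ (i + d) * ?w)"
      using eg unit_part_eq[of u 2] unit_part_eq[of v 2] unit_part_eq[of w 2] m(2) d(1)
      by (simp add: i_def)
    note eq = egyptian_reduced[OF prime this]
    \<comment> \<open>The exponents are 2 (i + d) and 2 i + d, so one \<open>chi8\<close> factor
      disappears and the other keeps the exponent d.\<close>
    have sym: "dyadic_symbol (- (u * w)) (- (v * w)) =
        eps4 (- (?u * ?w)) (- (?v * ?w)) * chi8 (- (?v * ?w)) ^ d"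
    proof -
      have "dyadic_symbol (- (u * w)) (- (v * w)) = eps4 (- (?u * ?w)) (- (?v * ?w))
          * chi8 (- (?u * ?w)) ^ (2 * (i + d)) * chi8 (- (?v * ?w)) ^ (2 * i + d)"
        using nz m(2)[symmetric] d(1)
        by (simp add: dyadic_symbol_def multiplicity_mult unit_part_mult i_def mult_2 add_ac)
      then show ?thesis by (simp only: chi power_add mult_1_right mult_1_left)
    qed
    have dvd: "2 ^ d dvd ?v + ?w"
    proof -
      have "2 ^ d dvd (n * ?u) * (?v + ?w)" using eq(2) by (simp only: mult.assoc)
      moreover have "coprime (2 ^ d) (n * ?u)" using n odd by simp
      ultimately show ?thesis by (simp add: coprime_dvd_mult_right_iff)
    qed
    \<comment> \<open>Hence - (v w) is congruent to an odd square modulo every power of 2 dividing v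
      + w: it is 1 modulo 4 if d = 2, and 1 modulo 8 if d is at least 3.\<close>
    have square: "- (?v * ?w) = ?v\<^sup>2 - ?v * (?v + ?w)"
      by (simp add: power2_eq_square algebra_simps)
    consider "d = 1" | "d = 2" | "d \<ge> 3" using d(2) by linarith
    then show "dyadic_symbol (- (u * w)) (- (v * w)) = 1"
    proof cases
      case 1
      then have "8 dvd n * (?u * (?v + ?w) + 2 * (?v * ?w))" using eq(1) by simp
      moreover have "coprime (2 ^ 3) n" using n by (subst coprime_power_left_iff) simp
      ultimately have "8 dvd ?u * (?v + ?w) + 2 * (?v * ?w)"
        by (simp add: coprime_dvd_mult_right_iff)
      with eps4_chi8_identity[OF odd] show ?thesis using sym 1 by simp
    next
      case 2
      then have "4 dvd ?v * (?v + ?w)" using dvd by simp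
      moreover have "?v\<^sup>2 mod 4 = 1" using odd_square_mod_8[OF odd(2)] mod_mod_cancel[of 4 8 "?v\<^sup>2"] by simp
      ultimately have "(- (?v * ?w)) mod 4 = 1" unfolding square by (simp only: mod_diff_dvd)
      then show ?thesis using sym 2 chi[of _ 1] by (simp add: eps4_def)
    next
      case 3
      have "8 dvd ?v + ?w"
        using le_imp_power_dvd[OF 3, of "2::int"] dvd by (simp add: dvd_trans)
      then have "8 dvd ?v * (?v + ?w)" by simp
      moreover have "?v\<^sup>2 mod 8 = 1"
        using odd(2) by (rule odd_square_mod_8)
      ultimately have "(- (?v * ?w)) mod 8 = 1" unfolding square by (simp only: mod_diff_dvd)
      moreover from this have "(- (?v * ?w)) mod 4 = 1"
        using mod_mod_cancel[of 4 8 "- (?v * ?w)"] by simp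
      ultimately show ?thesis using sym by (simp add: eps4_def chi8_def)
    qed
  next
    fix u v w assume eg: "egyptian n u v w"
      and m: "multiplicity 2 u = multiplicity 2 v" "multiplicity 2 v = multiplicity 2 w"
    let ?u = "unit_part 2 u" and ?v = "unit_part 2 v" and ?w = "unit_part 2 w"
    define i where "i = multiplicity 2 w"
    have nz: "u \<noteq> 0" "v \<noteq> 0" "w \<noteq> 0" using eg by (auto simp: egyptian_def)
    note odd = not_dvd_unit_part[OF prime nz(1)] not_dvd_unit_part[OF prime nz(2)]
      not_dvd_unit_part[OF prime nz(3)]
    have "egyptian n (2 ^ i * ?u) (2 ^ (i + 0) * ?v) (2 ^ (i + 0) * ?w)"
      using eg unit_part_eq[of u 2] unit_part_eq[of v 2] unit_part_eq[of w 2] m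
      by (simp add: i_def)
    \<comment> \<open>Three equal valuations cannot occur at 2: the reduced right side is a multiple
      of 4, while the left side is odd, being n times a sum of three odd products.\<close>
    from egyptian_reduced(1)[OF prime this]
    have "even (n * (?u * (?v + ?w) + ?v * ?w))" by simp
    then show "dyadic_symbol (- (u * w)) (- (v * w)) = 1" using n odd by simp
  qed
qed

theorem theorem1p2:
  fixes n u1 u2 u3 :: nat
  assumes "n > 0" and "odd n"
    and "u1 > 0" and "u2 > 0" and "u3 > 0"
    and "4 / rat_of_nat n = 1 / rat_of_nat u1 + 1 / rat_of_nat u2 + 1 / rat_of_nat u3"
  shows "(\<Prod>p\<in>prime_factors n.
            hilbert_symbol p (padic_of_rat p (- (rat_of_nat u1 / rat_of_nat u3)))
                             (padic_of_rat p (- (rat_of_nat u2 / rat_of_nat u3)))) = - 1"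
proof -
  define A B where "A = - (int u1 * int u3)" and "B = - (int u2 * int u3)"
  \<comment> \<open>The primes of u1 u2 u3 are there for the product formula, those of n so that the
    product in the claim extends to \<open>S\<close>.\<close>
  define S where "S = prime_factors (n * (u1 * u2 * u3)) - {2}"
  have "of_nat (4 * (u1 * u2 * u3)) = (of_nat (n * (u1 * u2 + u1 * u3 + u2 * u3)) :: rat)"
    using assms(6,1,3-5) by (simp add: field_simps)
  then have "4 * (u1 * u2 * u3) = n * (u1 * u2 + u1 * u3 + u2 * u3)"
    by (simp only: of_nat_eq_iff)
  then have "int (4 * (u1 * u2 * u3)) = int (n * (u1 * u2 + u1 * u3 + u2 * u3))" by (rule arg_cong)
  then have eg: "egyptian (int n) (int u1) (int u2) (int u3)" using assms(3-5) by (simp add: egyptian_def)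
  have nz: "n * (u1 * u2 * u3) \<noteq> 0" using assms by simp
  have S: "prime p \<and> 2 < p" if "p \<in> S" for p
    using that prime_ge_2_nat[of p] by (auto simp: S_def in_prime_factors_iff)
  have "finite S" by (simp add: S_def)
  have mem: "p = 2 \<or> p \<in> S" if "prime p" "p dvd u1 * u2 * u3" for p
    using that nz by (auto simp: S_def in_prime_factors_iff)
  have odd: "2 < p" if "p \<in> prime_factors n" for p
    using that assms(2) prime_ge_2_nat[of p] by (cases "p = 2") (auto simp: in_prime_factors_iff)
  have "(\<Prod>p\<in>prime_factors n.
            hilbert_symbol p (padic_of_rat p (- (rat_of_nat u1 / rat_of_nat u3)))
                             (padic_of_rat p (- (rat_of_nat u2 / rat_of_nat u3)))) =
      (\<Prod>p\<in>prime_factors n. tame_symbol p A B)"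
    using hilbert_symbol_eq_tame_symbol[of _ "int u1" "int u2" "int u3"] odd assms(3-5)
    by (intro prod.cong refl) (auto simp: A_def B_def in_prime_factors_iff)
  also have "\<dots> = (\<Prod>p\<in>S. tame_symbol p A B)"
  proof (rule prod.mono_neutral_left)
    show "prime_factors n \<subseteq> S" using odd nz by (force simp: S_def in_prime_factors_iff)
    show "\<forall>p\<in>S - prime_factors n. tame_symbol p A B = 1"
    proof
      fix p assume "p \<in> S - prime_factors n"
      then have "prime p" "2 < p" "\<not> int p dvd int n"
        using S assms(1) by (auto simp: in_prime_factors_iff)
      then show "tame_symbol p A B = 1"
        unfolding A_def B_def by (rule egyptian_tame_symbol[OF _ _ _ eg])
    qed
  qed fact
  also have "\<dots> = - 1"
  proof -
    have "total_symbol S A B = 1"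
    proof (rule hilbert_reciprocity[OF \<open>finite S\<close> S])
      show "A \<noteq> 0" "B \<noteq> 0" using assms by (auto simp: A_def B_def)
      fix p :: nat assume p: "prime p"
      show "p = 2 \<or> p \<in> S" if "int p dvd A"
        using that p by (intro mem) (auto simp: A_def simp flip: of_nat_mult simp: prime_dvd_mult_iff)
      show "p = 2 \<or> p \<in> S" if "int p dvd B"
        using that p by (intro mem) (auto simp: B_def simp flip: of_nat_mult simp: prime_dvd_mult_iff)
    qed
    moreover have "dyadic_symbol A B = 1"
      unfolding A_def B_def using assms(2) by (intro egyptian_dyadic_symbol[OF _ eg]) simp
    moreover have "real_symbol A B = - 1"
      using assms by (simp add: real_symbol_def A_def B_def)
    ultimately show ?thesis by (simp add: total_symbol_def[OF \<open>finite S\<close> S])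
  qed
  finally show ?thesis .
qed

end
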